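(* Of the 96 sign cells in the Grassmannian $G_2(\mathbb{R}^4)$, exactly 32 consist of planes corresponding to convex quadrilaterals, exactly 32 consist of planes corresponding to reflex quadrilaterals, and exactly 32 consist of planes corresponding to self-intersecting quadrilaterals. Hence the probabilities, with respect to the symmetric measure, that a randomly selected quadrilateral is convex, reflex, or self-intersecting are each equal to $1/3$.
   Context: $G_2(\mathbb{R}^4)$ is the Grassmannian of (unoriented) 2-planes in $\mathbb{R}^4$, with its unique $O(4)$-invariant probability measure. To a plane $P\in G_2(\mathbb{R}^4)$ with orthonormal basis $\vec u,\vec v$ one associates the closed planar quadrilateral of perimeter 2 whose consecutive edge vectors are, as complex numbers, $e_i=(u_i+\mathbf{i}v_i)^2$, $i=1,\dots,4$. A different orthonormal basis changes the quadrilateral only by a rotation or a reflection, which does not affect the classes below. The symmetric measure on quadrilaterals is the pushforward of the invariant probability measure on $G_2(\mathbb{R}^4)$ under this correspondence. A quadrilateral is self-intersecting if two opposite edges cross, reflex if it is embedded but not convex, and otherwise convex. Let $A$ be the $4\times 2$ matrix with columns $\vec u,\vec v$. The Plücker matrix of $P$ is the skew-symmetric matrix $\Delta(P)$ with $\Delta(P)_{ij}=u_iv_j-u_jv_i$ (defined up to a global sign depending on the orientation of the basis), and the projection matrix of $P$ is $AA^T$, with entries $u_iu_j+v_iv_j$ (independent of the orthonormal basis). A sign cell is a nonempty set of all planes $P$ having given sign matrices $\operatorname{sgn}\Delta(P)$ (up to a global sign) and $\operatorname{sgn}AA^T$, where $\Delta(P)_{ij}\neq 0$ for all $i\ne j$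 and all $(AA^T)_{ij}\neq 0$. *)

theory Defs
  imports "HOL-Probability.Probability"
begin

section \<open>The Grassmannian and its invariant probability measures\<close>

definition grassmannian :: "(real^4) set set" where
  "grassmannian = {P. subspace P \<and> dim P = 2}"

definition stiefel :: "((real^4) \<times> (real^4)) set" where
  "stiefel = {(u, v). norm u = 1 \<and> norm v = 1 \<and> u \<bullet> v = 0}"

definition orthonormal_basis :: "real^4 \<Rightarrow> real^4 \<Rightarrow> (real^4) set \<Rightarrow> bool" where
  "orthonormal_basis u v P \<longleftrightarrow> (u, v) \<in> stiefel \<and> span {u, v} = P"

text \<open>Borel sets of the quotient topology induced by \<open>(u, v) \<mapsto> span {u, v}\<close> on orthonormal pairs.\<close>

definition grassmannian_borel :: "(real^4) set measure" where
  "grassmannian_borel = sigma grassmannian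
     {U. U \<subseteq> grassmannian \<and>
         openin (top_of_set stiefel) {(u, v) \<in> stiefel. span {u, v} \<in> U}}"

definition invariant_probability :: "(real^4) set measure \<Rightarrow> bool" where
  "invariant_probability M \<longleftrightarrow>
     prob_space M \<and> sets M = sets grassmannian_borel \<and>
     (\<forall>g S. orthogonal_transformation g \<longrightarrow> S \<in> sets M \<longrightarrow>
        emeasure M ((\<lambda>P. g ` P) ` S) = emeasure M S)"

section \<open>Quadrilaterals\<close>

text \<open>A quadrilateral is given, up to translation, by its edge vectors.\<close>

definition quads :: "(complex^4) set" where
  "quads = {e. (\<Sum>i\<in>UNIV. e $ i) = 0 \<and> (\<Sum>i\<in>UNIV. norm (e $ i)) = 2}"

text \<open>Congruence by rotations and reflections; linear isometries of the plane.\<close>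

definition congruence :: "((complex^4) \<times> (complex^4)) set" where
  "congruence = {(e, e'). e \<in> quads \<and> e' \<in> quads \<and>
     (\<exists>f. orthogonal_transformation f \<and> (\<forall>i. e' $ i = f (e $ i)))}"

definition quad_classes :: "(complex^4) set set" where
  "quad_classes = quads // congruence"

definition quad_edges :: "real^4 \<Rightarrow> real^4 \<Rightarrow> complex^4" where
  "quad_edges u v = (\<chi> i. (complex_of_real (u $ i) + \<i> * complex_of_real (v $ i))^2)"

text \<open>The quadrilaterals obtained from all orthonormal bases of a plane form exactly one
  congruence class.\<close>

definition quad_of_plane :: "(real^4) set \<Rightarrow> (complex^4) set" where
  "quad_of_plane P = {quad_edges u v | u v. orthonormal_basis u v P}"

definition vert1 :: "complex^4 \<Rightarrow> complex" where "vert1 e = 0"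
definition vert2 :: "complex^4 \<Rightarrow> complex" where "vert2 e = e $ 1"
definition vert3 :: "complex^4 \<Rightarrow> complex" where "vert3 e = e $ 1 + e $ 2"
definition vert4 :: "complex^4 \<Rightarrow> complex" where "vert4 e = e $ 1 + e $ 2 + e $ 3"

definition quad_path :: "complex^4 \<Rightarrow> real \<Rightarrow> complex" where
  "quad_path e = linepath (vert1 e) (vert2 e) +++ linepath (vert2 e) (vert3 e)
             +++ linepath (vert3 e) (vert4 e) +++ linepath (vert4 e) (vert1 e)"

definition self_intersecting :: "complex^4 \<Rightarrow> bool" where
  "self_intersecting e \<longleftrightarrow>
     closed_segment (vert1 e) (vert2 e) \<inter> closed_segment (vert3 e) (vert4 e) \<noteq> {} \<or>
     closed_segment (vert2 e) (vert3 e) \<inter> closed_segment (vert4 e) (vert1 e) \<noteq> {}"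

definition embedded :: "complex^4 \<Rightarrow> bool" where
  "embedded e \<longleftrightarrow> simple_path (quad_path e)"

text \<open>\<open>inside\<close> is the union of the bounded components of the complement, so this is
  convexity of the region enclosed by the polygon.\<close>

definition convex_region :: "complex^4 \<Rightarrow> bool" where
  "convex_region e \<longleftrightarrow> convex (inside (path_image (quad_path e)))"

definition reflex :: "complex^4 \<Rightarrow> bool" where
  "reflex e \<longleftrightarrow> embedded e \<and> \<not> convex_region e"

text \<open>Closed quadrilaterals whose opposite edges are disjoint are embedded, so the remaining
  class consists of the embedded quadrilaterals with convex enclosed region.\<close>

definition convex_quad :: "complex^4 \<Rightarrow> bool" where
  "convex_quad e \<longleftrightarrow> \<not> self_intersecting e \<and> \<not> reflex e"

text \<open>The pushforward lives on the final sigma-algebra of the completed measure: the degenerate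
  quadrilaterals form a null set.\<close>

definition symmetric_measure :: "(real^4) set measure \<Rightarrow> (complex^4) set measure" where
  "symmetric_measure M = distr (completion M)
     (sigma quad_classes
        {A. A \<subseteq> quad_classes \<and> quad_of_plane -` A \<inter> space M \<in> sets (completion M)})
     quad_of_plane"

section \<open>Sign cells\<close>

definition plucker :: "real^4 \<Rightarrow> real^4 \<Rightarrow> real^4^4" where
  "plucker u v = (\<chi> i j. u $ i * v $ j - u $ j * v $ i)"

definition basis_matrix :: "real^4 \<Rightarrow> real^4 \<Rightarrow> real^2^4" where
  "basis_matrix u v = (\<chi> i j. if j = 1 then u $ i else v $ i)"

definition projection_matrix :: "real^4 \<Rightarrow> real^4 \<Rightarrow> real^4^4" where
  "projection_matrix u v = basis_matrix u v ** transpose (basis_matrix u v)"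

definition sign_matrix :: "real^4^4 \<Rightarrow> real^4^4" where
  "sign_matrix B = (\<chi> i j. sgn (B $ i $ j))"

definition planes_with_signs :: "real^4^4 \<Rightarrow> real^4^4 \<Rightarrow> (real^4) set set" where
  "planes_with_signs S T = {P \<in> grassmannian. \<exists>u v. orthonormal_basis u v P \<and>
     (sign_matrix (plucker u v) = S \<or> sign_matrix (plucker u v) = - S) \<and>
     sign_matrix (projection_matrix u v) = T}"

definition sign_cells :: "(real^4) set set set" where
  "sign_cells = {planes_with_signs S T | S T. planes_with_signs S T \<noteq> {} \<and>
     (\<forall>i j. i \<noteq> j \<longrightarrow> S $ i $ j \<noteq> 0) \<and> (\<forall>i j. T $ i $ j \<noteq> 0)}"

section \<open>The quadrilaterals of a plane form one congruence class\<close>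

lemma plane_has_orthonormal_basis:
  assumes "P \<in> grassmannian"
  obtains u v where "orthonormal_basis u v P"
proof -
  have P: "subspace P" "dim P = 2" using assms by (auto simp: grassmannian_def)
  obtain B where B: "B \<subseteq> P" "pairwise orthogonal B" "\<And>x. x \<in> B \<Longrightarrow> norm x = 1"
    "independent B" "card B = dim P" "span B = P"
    using orthonormal_basis_subspace[OF P(1)] by blast
  then obtain u v where uv: "B = {u, v}" "u \<noteq> v" using P(2) by (metis card_2_iff)
  then have "orthonormal_basis u v P"
    using B by (auto simp: orthonormal_basis_def stiefel_def pairwise_def orthogonal_def)
  then show thesis by (rule that)
qed

lemma quad_edges_Complex: "quad_edges u v $ i = (Complex (u $ i) (v $ i))\<^sup>2"
  by (simp add: quad_edges_def complex_eq_iff power2_eq_square)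

lemma quad_edges_quads:
  assumes "(u, v) \<in> stiefel" shows "quad_edges u v \<in> quads"
proof -
  have u: "(\<Sum>i\<in>UNIV. (u $ i)\<^sup>2) = 1" and v: "(\<Sum>i\<in>UNIV. (v $ i)\<^sup>2) = 1"
    and uv: "(\<Sum>i\<in>UNIV. u $ i * v $ i) = 0"
    using assms by (auto simp: stiefel_def norm_eq_1 inner_vec_def power2_eq_square)
  have "(\<Sum>i\<in>UNIV. quad_edges u v $ i) = 0"
    using u v uv by (simp add: complex_eq_iff quad_edges_Complex Re_power2 Im_power2 sum_subtractf
        sum_distrib_left[symmetric] mult.assoc)
  moreover have "(\<Sum>i\<in>UNIV. norm (quad_edges u v $ i)) = 2"
    using u v by (simp add: quad_edges_Complex norm_power cmod_power2 sum.distrib)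
  ultimately show ?thesis by (simp add: quads_def)
qed

lemma Re_Im_combination1: "d = \<i> * c \<Longrightarrow> Re z *\<^sub>R c + Im z *\<^sub>R d = c * z"
  by (simp add: complex_eq_iff algebra_simps)

lemma Re_Im_combination2: "d = (- \<i>) * c \<Longrightarrow> Re z *\<^sub>R c + Im z *\<^sub>R d = c * cnj z"
  by (simp add: complex_eq_iff algebra_simps)

lemma orthogonal_complex_cases:
  fixes f :: "complex \<Rightarrow> complex"
  assumes f: "orthogonal_transformation f"
  obtains c where "norm c = 1" "(\<forall>z. f z = c * z) \<or> (\<forall>z. f z = c * cnj z)"
proof -
  have lin: "linear f" using f orthogonal_transformation_linear by blast
  let ?c = "f 1" and ?d = "f \<i>"
  have n: "norm ?c = 1" "norm ?d = 1" "?c \<bullet> ?d = 0"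
    using f by (simp_all add: orthogonal_transformation_norm orthogonal_transformation_def inner_complex_def)
  have fz: "f z = Re z *\<^sub>R ?c + Im z *\<^sub>R ?d" for z
  proof -
    have "z = Re z *\<^sub>R 1 + Im z *\<^sub>R \<i>" by (simp add: complex_eq_iff)
    then show ?thesis using lin by (metis linear_add linear_scale)
  qed
  define e where "e = ?d / ?c"
  have c0: "?c \<noteq> 0" using n by auto
  have d: "?d = e * ?c" using c0 by (simp add: e_def)
  have "norm e = 1" using n by (simp add: e_def norm_divide)
  have "Re e = 0"
  proof -
    have "?c \<bullet> ?d = Re e * ((Re ?c)\<^sup>2 + (Im ?c)\<^sup>2)"
      unfolding d by (simp add: inner_complex_def power2_eq_square algebra_simps)
    also have "\<dots> = Re e" using n(1) by (simp flip: cmod_power2)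
    finally show ?thesis using n(3) by simp
  qed
  then have "\<bar>Im e\<bar> = 1" using \<open>norm e = 1\<close> by (simp add: cmod_def)
  then have "Im e = 1 \<or> Im e = -1" by linarith
  then have "e = \<i> \<or> e = - \<i>" using \<open>Re e = 0\<close> by (simp add: complex_eq_iff)
  then show thesis
  proof
    assume "e = \<i>"
    then have "?d = (\<i>) * ?c" using d by (simp only:)
    then have "f z = ?c * z" for z by (rule trans[OF fz[of z] Re_Im_combination1])
    then show thesis by (intro that[OF n(1)] disjI1 allI)
  next
    assume "e = - \<i>"
    then have "?d = (- \<i>) * ?c" using d by (simp only:)
    then have "f z = ?c * cnj z" for z by (rule trans[OF fz[of z] Re_Im_combination2])
    then show thesis by (intro that[OF n(1)] disjI2 allI)
  qed
qed

lemma orthogonal_complex_mult: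
  assumes "norm c = 1"
  shows "orthogonal_transformation (\<lambda>z. c * z)" "orthogonal_transformation (\<lambda>z. c * cnj z)"
proof -
  have 1: "linear (\<lambda>z. c * z)" by (intro linearI) (simp_all add: algebra_simps)
  have 2: "linear (\<lambda>z. c * cnj z)" by (intro linearI) (simp_all add: algebra_simps)
  show "orthogonal_transformation (\<lambda>z. c * z)" "orthogonal_transformation (\<lambda>z. c * cnj z)"
    unfolding orthogonal_transformation using 1 2 assms by (simp_all add: norm_mult)
qed

lemma rotate_basis:
  assumes uv: "orthonormal_basis u v P" and ab: "a\<^sup>2 + b\<^sup>2 = 1" and s: "s = 1 \<or> s = -1"
  shows "orthonormal_basis (a *\<^sub>R u + b *\<^sub>R v) (s *\<^sub>R (a *\<^sub>R v - b *\<^sub>R u)) P"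
proof -
  let ?x = "a *\<^sub>R u + b *\<^sub>R v" and ?y = "s *\<^sub>R (a *\<^sub>R v - b *\<^sub>R u)"
  have o: "u \<bullet> u = 1" "v \<bullet> v = 1" "u \<bullet> v = 0" "v \<bullet> u = 0" and P: "P = span {u, v}"
    using uv by (auto simp: orthonormal_basis_def stiefel_def norm_eq_1 inner_commute)
  have ss: "s * s = 1" using s by auto
  have "?x \<bullet> ?x = 1" "?y \<bullet> ?y = 1" "?x \<bullet> ?y = 0"
    using o ab ss s by (auto simp: inner_add_left inner_add_right inner_diff_left inner_diff_right power2_eq_square)
  then have st: "(?x, ?y) \<in> stiefel" by (simp add: stiefel_def norm_eq_1)
  have u: "u = a *\<^sub>R ?x - (s * b) *\<^sub>R ?y"
  proof -
    have "a *\<^sub>R ?x - (s * b) *\<^sub>R ?y = (a\<^sup>2 + (s * s) * b\<^sup>2) *\<^sub>R u + (a * b - (s * s) * (a * b)) *\<^sub>R v"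
      by (simp add: algebra_simps power2_eq_square)
    then show ?thesis using ab ss by simp
  qed
  have v: "v = b *\<^sub>R ?x + (s * a) *\<^sub>R ?y"
  proof -
    have "b *\<^sub>R ?x + (s * a) *\<^sub>R ?y = (a * b - (s * s) * (a * b)) *\<^sub>R u + ((s * s) * a\<^sup>2 + b\<^sup>2) *\<^sub>R v"
      by (simp add: algebra_simps power2_eq_square)
    then show ?thesis using ab ss by simp
  qed
  have "?x \<in> span {u, v}" "?y \<in> span {u, v}"
    by (intro span_mul span_add span_diff span_base; simp)+
  moreover have "?x \<in> span {?x, ?y}" "?y \<in> span {?x, ?y}"
    by (simp_all add: span_base)
  then have "a *\<^sub>R ?x - (s * b) *\<^sub>R ?y \<in> span {?x, ?y}" "b *\<^sub>R ?x + (s * a) *\<^sub>R ?y \<in> span {?x, ?y}"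
    by (blast intro: span_mul span_add span_diff)+
  then have "u \<in> span {?x, ?y}" "v \<in> span {?x, ?y}" by (simp_all only: u[symmetric] v[symmetric])
  ultimately have "span {?x, ?y} = span {u, v}" by (intro antisym span_minimal) auto
  then show ?thesis using st P by (simp add: orthonormal_basis_def)
qed

lemma span_pair_obtain:
  fixes u v :: "'a::real_vector"
  assumes "x \<in> span {u, v}"
  obtains a b where "x = a *\<^sub>R u + b *\<^sub>R v"
proof -
  obtain a where "x - a *\<^sub>R u \<in> span {v}" using assms by (auto simp: span_breakdown_eq)
  then obtain b where "x - a *\<^sub>R u = b *\<^sub>R v" by (auto simp: span_singleton)
  then have "x = a *\<^sub>R u + b *\<^sub>R v" by (simp add: algebra_simps)
  then show thesis by (rule that)
qed

lemma quad_of_plane_eq_class: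
  assumes uv: "orthonormal_basis u v P"
  shows "quad_of_plane P = congruence `` {quad_edges u v}"
proof (intro set_eqI iffI)
  have o: "u \<bullet> u = 1" "v \<bullet> v = 1" "u \<bullet> v = 0" "v \<bullet> u = 0" and P: "P = span {u, v}"
    using uv by (auto simp: orthonormal_basis_def stiefel_def norm_eq_1 inner_commute)
  have q: "quad_edges u v \<in> quads" using uv quad_edges_quads by (simp add: orthonormal_basis_def)
  fix e
  {
    assume "e \<in> quad_of_plane P"
    then obtain x y where xy: "orthonormal_basis x y P" and e: "e = quad_edges x y"
      by (auto simp: quad_of_plane_def)
    have o': "x \<bullet> x = 1" "y \<bullet> y = 1" "x \<bullet> y = 0" and P': "P = span {x, y}"
      using xy by (auto simp: orthonormal_basis_def stiefel_def norm_eq_1)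
    have "x \<in> span {u, v}" "y \<in> span {u, v}"
      unfolding P[symmetric] unfolding P' by (simp_all add: span_base)
    then obtain a b c d where x: "x = a *\<^sub>R u + b *\<^sub>R v" and y: "y = c *\<^sub>R u + d *\<^sub>R v"
      by (meson span_pair_obtain)
    have ab: "a\<^sup>2 + b\<^sup>2 = 1" and cd: "c\<^sup>2 + d\<^sup>2 = 1" and acbd: "a * c + b * d = 0"
      using o' o unfolding x y by (simp_all add: inner_add_left inner_add_right power2_eq_square mult.commute)
    define s where "s = a * d - b * c"
    have c: "c = - s * b" and d: "d = s * a"
      using ab cd acbd unfolding s_def by algebra+
    have "s\<^sup>2 = 1" using ab cd acbd unfolding s_def by algebra
    then have s: "s = 1 \<or> s = -1" by (simp add: power2_eq_1_iff)
    let ?w = "Complex a (- s * b)"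
    have "norm ?w = 1" using ab s by (auto simp: cmod_def)
    then have nw: "norm (?w\<^sup>2) = 1" by (simp only: norm_power power_one)
    have "\<exists>f. orthogonal_transformation f \<and> (\<forall>i. e $ i = f (quad_edges u v $ i))"
    proof (cases "s = 1")
      case True
      have "e $ i = ?w\<^sup>2 * (quad_edges u v $ i)" for i
      proof -
        have "Complex (x $ i) (y $ i) = ?w * Complex (u $ i) (v $ i)"
          using True by (simp add: x y c d complex_eq_iff)
        then show ?thesis by (simp add: e quad_edges_Complex power_mult_distrib)
      qed
      then show ?thesis using orthogonal_complex_mult(1)[OF nw] by blast
    next
      case False
      then have "s = -1" using s by simp
      have "e $ i = ?w\<^sup>2 * cnj (quad_edges u v $ i)" for i
      proof -
        have "Complex (x $ i) (y $ i) = ?w * cnj (Complex (u $ i) (v $ i))"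
          using \<open>s = -1\<close> by (simp add: x y c d complex_eq_iff)
        then show ?thesis by (simp add: e quad_edges_Complex power_mult_distrib)
      qed
      then show ?thesis using orthogonal_complex_mult(2)[OF nw] by blast
    qed
    moreover have "e \<in> quads" using xy quad_edges_quads by (simp add: e orthonormal_basis_def)
    ultimately show "e \<in> congruence `` {quad_edges u v}" using q by (auto simp: congruence_def)
  next
    assume "e \<in> congruence `` {quad_edges u v}"
    then obtain f where f: "orthogonal_transformation f" and e: "\<And>i. e $ i = f (quad_edges u v $ i)"
      by (auto simp: congruence_def)
    obtain k where k: "norm k = 1" "(\<forall>z. f z = k * z) \<or> (\<forall>z. f z = k * cnj z)"
      using orthogonal_complex_cases[OF f] by blast
    define w where "w = csqrt k"
    have w2: "w\<^sup>2 = k" by (simp add: w_def)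
    have "(norm w)\<^sup>2 = 1" by (simp only: norm_power[symmetric] w2 k(1))
    then have wn: "(Re w)\<^sup>2 + (- Im w)\<^sup>2 = 1" "(Re w)\<^sup>2 + (Im w)\<^sup>2 = 1" by (simp_all add: cmod_power2)
    from k(2) show "e \<in> quad_of_plane P"
    proof
      assume fk: "\<forall>z. f z = k * z"
      let ?x = "Re w *\<^sub>R u + (- Im w) *\<^sub>R v" and ?y = "1 *\<^sub>R (Re w *\<^sub>R v - (- Im w) *\<^sub>R u)"
      have "quad_edges ?x ?y $ i = e $ i" for i
      proof -
        have "Complex (?x $ i) (?y $ i) = w * Complex (u $ i) (v $ i)" by (simp add: complex_eq_iff)
        then show ?thesis by (simp add: e fk quad_edges_Complex power_mult_distrib w2 del: scaleR_one)
      qed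
      then have "e = quad_edges ?x ?y" by (simp add: vec_eq_iff)
      moreover have "orthonormal_basis ?x ?y P"
        by (rule rotate_basis[OF uv wn(1)]) simp
      ultimately show ?thesis unfolding quad_of_plane_def mem_Collect_eq by (intro exI conjI)
    next
      assume fk: "\<forall>z. f z = k * cnj z"
      let ?x = "Re w *\<^sub>R u + Im w *\<^sub>R v" and ?y = "(- 1) *\<^sub>R (Re w *\<^sub>R v - Im w *\<^sub>R u)"
      have "quad_edges ?x ?y $ i = e $ i" for i
      proof -
        have "Complex (?x $ i) (?y $ i) = w * cnj (Complex (u $ i) (v $ i))" by (simp add: complex_eq_iff)
        then show ?thesis by (simp add: e fk quad_edges_Complex power_mult_distrib w2)
      qed
      then have "e = quad_edges ?x ?y" by (simp add: vec_eq_iff)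
      moreover have "orthonormal_basis ?x ?y P"
        by (rule rotate_basis[OF uv wn(2)]) simp
      ultimately show ?thesis unfolding quad_of_plane_def mem_Collect_eq by (intro exI conjI)
    qed
  }
qed

lemma quad_of_plane_in_quad_classes:
  assumes "P \<in> grassmannian" shows "quad_of_plane P \<in> quad_classes"
proof -
  obtain u v where uv: "orthonormal_basis u v P" using plane_has_orthonormal_basis[OF assms] .
  then have "quad_edges u v \<in> quads" using quad_edges_quads by (simp add: orthonormal_basis_def)
  then show ?thesis unfolding quad_of_plane_eq_class[OF uv] quad_classes_def by (rule quotientI)
qed

section \<open>Existence of an invariant probability measure\<close>

text \<open>Witness: normalised Lebesgue measure on pairs of linearly independent vectors in the unit
  ball, pushed forward by the span.\<close>

lemma lborel_distr_orthogonal: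
  fixes g :: "real^4 \<Rightarrow> real^4"
  assumes g: "orthogonal_transformation g"
  shows "distr lborel lborel g = lborel"
proof -
  have lin: "linear g" using g orthogonal_transformation_linear by blast
  have gm: "g \<in> borel_measurable borel"
    using lin
    by (intro borel_measurable_continuous_onI linear_continuous_on linear_conv_bounded_linear[THEN iffD1])
  let ?h = "inv g"
  have h: "orthogonal_transformation ?h" by (rule orthogonal_transformation_inv[OF g])
  have "lborel = distr lborel lborel g"
  proof (rule lborel_eqI)
    fix l u :: "real^4" assume lu: "\<And>b. b \<in> Basis \<Longrightarrow> l \<bullet> b \<le> u \<bullet> b"
    have eq: "g -` box l u = ?h ` box l u"
      using bij_vimage_eq_inv_image[OF orthogonal_transformation_bij[OF g]] by blast
    have lm: "?h ` box l u \<in> lmeasurable"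
      by (rule measurable_orthogonal_image[OF h]) simp
    have bs: "g -` box l u \<in> sets borel"
      using measurable_sets[OF gm, of "box l u"] by simp
    have "emeasure (distr lborel lborel g) (box l u) = emeasure lborel (g -` box l u)"
      using gm by (subst emeasure_distr) auto
    also have "\<dots> = emeasure lebesgue (g -` box l u)" using bs by simp
    also have "\<dots> = ennreal (measure lebesgue (?h ` box l u))"
      unfolding eq using lm by (simp add: emeasure_eq_measure2)
    also have "\<dots> = ennreal (measure lebesgue (box l u))"
      by (subst measure_orthogonal_image[OF h]) simp_all
    also have "\<dots> = (\<Prod>b\<in>Basis. (u - l) \<bullet> b)"
      using lu by (simp add: measure_lborel_box_eq)
    finally show "emeasure (distr lborel lborel g) (box l u) = (\<Prod>b\<in>Basis. (u - l) \<bullet> b)" .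
  qed simp
  then show ?thesis by simp
qed

lemma lborel_distr_orthogonal_pair:
  fixes g :: "real^4 \<Rightarrow> real^4"
  assumes g: "orthogonal_transformation g"
  shows "distr lborel lborel (\<lambda>(x, y). (g x, g y)) = lborel"
proof -
  have lin: "linear g" using g orthogonal_transformation_linear by blast
  have gm: "g \<in> measurable lborel lborel"
    using lin
    by (simp, intro borel_measurable_continuous_onI linear_continuous_on linear_conv_bounded_linear[THEN iffD1])
  have "lborel \<Otimes>\<^sub>M lborel = distr (lborel \<Otimes>\<^sub>M lborel) (lborel \<Otimes>\<^sub>M lborel) (\<lambda>(x, y). (g x, g y))"
    using pair_measure_distr[OF gm gm] by (simp add: lborel_distr_orthogonal[OF g] sigma_finite_lborel)
  then show ?thesis by (simp add: lborel_prod)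
qed

lemma space_grassmannian_borel: "space grassmannian_borel = grassmannian"
  unfolding grassmannian_borel_def by (intro space_measure_of) auto

lemma sets_grassmannian_borel: "sets grassmannian_borel = sigma_sets grassmannian
     {U. U \<subseteq> grassmannian \<and>
         openin (top_of_set stiefel) {(u, v) \<in> stiefel. span {u, v} \<in> U}}"
  unfolding grassmannian_borel_def by (intro sets_measure_of) auto

lemma orthogonal_image_grassmannian:
  assumes "orthogonal_transformation g" "P \<in> grassmannian"
  shows "g ` P \<in> grassmannian"
proof -
  have "linear g" "inj g"
    using assms orthogonal_transformation_linear orthogonal_transformation_inj by blast+
  then show ?thesis using assms(2)
    unfolding grassmannian_def by (auto simp: linear_subspace_image dim_image_eq inj_on_subset[OF _ subset_UNIV])
qed

lemma orthogonal_action_measurable: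
  assumes g: "orthogonal_transformation g"
  shows "(\<lambda>P. g ` P) \<in> measurable grassmannian_borel grassmannian_borel"
  unfolding grassmannian_borel_def
proof (rule measurable_measure_of, goal_cases)
  case 2 then show ?case using orthogonal_image_grassmannian[OF g] by (auto simp: space_grassmannian_borel[unfolded grassmannian_borel_def])
next
  case (3 U)
  have lin: "linear g" using g orthogonal_transformation_linear by blast
  let ?G = "\<lambda>(x, y). (g x, g y)"
  let ?V = "{P \<in> grassmannian. g ` P \<in> U}"
  have sp: "span {g u, g v} = g ` span {u, v}" for u v
    using linear_span_image[OF lin, of "{u,v}"] by simp
  have st: "?G ` stiefel \<subseteq> stiefel"
    using g by (auto simp: stiefel_def orthogonal_transformation_norm orthogonal_transformation_def)
  have cont: "continuous_on stiefel ?G"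
    unfolding case_prod_beta using lin
    by (intro continuous_intros linear_continuous_on_compose[OF _ lin])
  have "openin (top_of_set stiefel) (stiefel \<inter> ?G -` {(u, v) \<in> stiefel. span {u, v} \<in> U})"
    using continuous_openin_preimage[OF cont] st 3 by blast
  moreover have "stiefel \<inter> ?G -` {(u, v) \<in> stiefel. span {u, v} \<in> U} = {(u, v) \<in> stiefel. span {u, v} \<in> ?V}"
  proof -
    have "(u,v) \<in> stiefel \<Longrightarrow> span {g u, g v} \<in> U \<Longrightarrow> span {u, v} \<in> grassmannian" for u v
    proof -
      assume "(u,v) \<in> stiefel" "span {g u, g v} \<in> U"
      then have "g ` span {u, v} \<in> grassmannian" using 3 sp by auto
      then have "dim (g ` span {u, v}) = 2" by (simp add: grassmannian_def)
      then have "dim (span {u, v}) = 2"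
        using dim_image_eq[OF lin] orthogonal_transformation_inj[OF g] by (metis inj_on_subset top_greatest)
      then show ?thesis by (simp add: grassmannian_def)
    qed
    moreover have "(u, v) \<in> stiefel \<Longrightarrow> (g u, g v) \<in> stiefel" for u v
      using st by blast
    ultimately show ?thesis using sp by auto
  qed
  ultimately have "?V \<in> sets grassmannian_borel"
    unfolding sets_grassmannian_borel by (intro sigma_sets.Basic) auto
  moreover have "(\<lambda>P. g ` P) -` U \<inter> grassmannian = ?V" by auto
  ultimately show ?case by (simp add: space_grassmannian_borel[unfolded grassmannian_borel_def] grassmannian_borel_def)
qed auto

definition gram_vector :: "real^4 \<Rightarrow> real^4 \<Rightarrow> real^4" where "gram_vector x y = (x \<bullet> x) *\<^sub>R y - (x \<bullet> y) *\<^sub>R x"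

definition independent_pairs :: "((real^4) \<times> (real^4)) set" where
  "independent_pairs = {p. fst p \<noteq> 0 \<and> gram_vector (fst p) (snd p) \<noteq> 0 \<and> norm (fst p) < 1 \<and> norm (snd p) < 1}"

definition gram_schmidt :: "((real^4) \<times> (real^4)) \<Rightarrow> (real^4) \<times> (real^4)" where
  "gram_schmidt p = (inverse (norm (fst p)) *\<^sub>R fst p, inverse (norm (gram_vector (fst p) (snd p))) *\<^sub>R gram_vector (fst p) (snd p))"

lemma gram_vector_orth: "x \<bullet> gram_vector x y = 0"
  by (simp add: gram_vector_def inner_diff_right inner_commute)

lemma gram_schmidt_stiefel: "p \<in> independent_pairs \<Longrightarrow> gram_schmidt p \<in> stiefel"
  by (auto simp: gram_schmidt_def stiefel_def independent_pairs_def gram_vector_orth)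

lemma gram_schmidt_span: assumes "p \<in> independent_pairs" shows "span {fst (gram_schmidt p), snd (gram_schmidt p)} = span {fst p, snd p}"
proof -
  obtain x y where p: "p = (x, y)" by force
  have x: "x \<noteq> 0" and w: "gram_vector x y \<noteq> 0" using assms by (auto simp: independent_pairs_def p)
  let ?a = "inverse (norm x) *\<^sub>R x" and ?b = "inverse (norm (gram_vector x y)) *\<^sub>R gram_vector x y"
  have "?a \<in> span {x,y}" "?b \<in> span {x,y}"
    unfolding gram_vector_def by (intro span_mul span_diff span_base; simp)+
  moreover have xs: "x \<in> span {?a,?b}"
  proof -
    have "norm x *\<^sub>R ?a \<in> span {?a,?b}" by (intro span_mul span_base) simp
    then show ?thesis using x by simp
  qed
  moreover have "y \<in> span {?a,?b}"
  proof -
    have "norm (gram_vector x y) *\<^sub>R ?b \<in> span {?a,?b}" by (intro span_mul span_base) simp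
    then have "gram_vector x y \<in> span {?a,?b}" using w by simp
    then have "inverse (x \<bullet> x) *\<^sub>R (gram_vector x y + (x \<bullet> y) *\<^sub>R x) \<in> span {?a,?b}"
      by (intro span_mul span_add xs)
    then show ?thesis using x by (simp add: gram_vector_def)
  qed
  ultimately show ?thesis unfolding gram_schmidt_def p
    by (intro antisym span_minimal) auto
qed

lemma span_stiefel: assumes "(u, v) \<in> stiefel" shows "span {u, v} \<in> grassmannian"
proof -
  have uv: "norm u = 1" "norm v = 1" "u \<bullet> v = 0" using assms by (auto simp: stiefel_def)
  then have ne: "u \<noteq> v" "u \<noteq> 0" "v \<noteq> 0" by (auto simp: dot_square_norm)
  have "independent {u, v}"
    by (rule pairwise_orthogonal_independent)
       (use uv ne in \<open>auto simp: pairwise_def orthogonal_def inner_commute\<close>)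
  then have "dim {u, v} = 2" using ne dim_eq_card_independent[of "{u,v}"] by simp
  then show ?thesis by (simp add: grassmannian_def)
qed

lemma gram_vector_cont: "continuous_on S (\<lambda>p. gram_vector (fst p) (snd p))"
  unfolding gram_vector_def by (intro continuous_intros)

lemma open_independent_pairs: "open independent_pairs"
  unfolding independent_pairs_def
  by (intro open_Collect_conj open_Collect_neq open_Collect_less gram_vector_cont continuous_intros)

lemma invariant_probability_exists: "\<exists>M. invariant_probability M"
proof -
  define a b :: "real^4" where "a = axis 1 1" and "b = axis 2 1"
  have st0: "(a, b) \<in> stiefel" by (auto simp: a_def b_def stiefel_def inner_axis_axis)
  define P0 where "P0 = span {a, b}"
  have P0: "P0 \<in> grassmannian" unfolding P0_def by (rule span_stiefel[OF st0])
  define f where "f p = (if p \<in> independent_pairs then span {fst p, snd p} else P0)" for p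
  have fA: "p \<in> independent_pairs \<Longrightarrow> f p \<in> grassmannian" for p
    using span_stiefel[of "fst (gram_schmidt p)" "snd (gram_schmidt p)"] gram_schmidt_stiefel[of p] gram_schmidt_span[of p] by (simp add: f_def)
  have AAb: "independent_pairs \<in> sets borel" using open_independent_pairs by simp
  have fm: "f \<in> measurable borel grassmannian_borel"
    unfolding grassmannian_borel_def
  proof (rule measurable_measure_of, goal_cases)
    case 2 show ?case using fA P0 by (auto simp: f_def) 
  next
    case (3 U)
    have cont: "continuous_on independent_pairs gram_schmidt"
      unfolding gram_schmidt_def by (intro continuous_intros gram_vector_cont) (auto simp: independent_pairs_def)
    have "openin (top_of_set independent_pairs) (independent_pairs \<inter> gram_schmidt -` {(u, v) \<in> stiefel. span {u, v} \<in> U})"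
      using continuous_openin_preimage[OF cont, of stiefel] gram_schmidt_stiefel 3 by blast
    then have "open (independent_pairs \<inter> gram_schmidt -` {(u, v) \<in> stiefel. span {u, v} \<in> U})"
      using open_independent_pairs openin_open_eq by blast
    moreover have "independent_pairs \<inter> gram_schmidt -` {(u, v) \<in> stiefel. span {u, v} \<in> U} = independent_pairs \<inter> f -` U"
      using gram_schmidt_stiefel gram_schmidt_span by (auto simp: f_def case_prod_beta)
    ultimately have "independent_pairs \<inter> f -` U \<in> sets borel" by simp
    then have "(independent_pairs \<inter> f -` U) \<union> (if P0 \<in> U then - independent_pairs else {}) \<in> sets borel"
      using AAb by auto
    also have "(independent_pairs \<inter> f -` U) \<union> (if P0 \<in> U then - independent_pairs else {}) = f -` U"
      unfolding f_def by (auto split: if_splits)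
    finally have "f -` U \<in> sets borel" .
    then show ?case by simp
  qed auto
  let ?N = "uniform_measure lborel independent_pairs"
  have "(inverse 2 *\<^sub>R a, inverse 2 *\<^sub>R b) \<in> independent_pairs"
  proof -
    have "a \<bullet> b = 0" "norm a = 1" "norm b = 1" "a \<noteq> 0" "b \<noteq> 0" using st0 by (auto simp: stiefel_def)
    then show ?thesis by (simp add: independent_pairs_def gram_vector_def dot_square_norm)
  qed
  then have ne: "independent_pairs \<noteq> {}" by blast
  have nz: "emeasure lborel independent_pairs \<noteq> 0"
  proof
    assume "emeasure lborel independent_pairs = 0"
    then have "independent_pairs \<in> null_sets lborel" using AAb by (intro null_setsI) auto
    then have "negligible independent_pairs"
      unfolding negligible_iff_null_sets by (rule null_sets_completionI)
    then show False using open_not_negligible[OF open_independent_pairs ne] by contradiction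
  qed
  have "bounded independent_pairs"
    by (rule bounded_subset[of "ball 0 1 \<times> ball 0 1"]) (auto simp: independent_pairs_def bounded_Times)
  then have fin: "emeasure lborel independent_pairs \<noteq> \<infinity>" using emeasure_bounded_finite[of independent_pairs] by simp
  interpret N: prob_space ?N by (rule prob_space_uniform_measure[OF nz fin])
  have fm': "f \<in> measurable ?N grassmannian_borel" using fm by (simp add: measurable_def)
  let ?M = "distr ?N grassmannian_borel f"
  have ps: "prob_space ?M" by (rule N.prob_space_distr[OF fm'])
  have val: "emeasure ?M S = emeasure lborel (independent_pairs \<inter> f -` S) / emeasure lborel independent_pairs"
    if "S \<in> sets grassmannian_borel" for S
    using that AAb measurable_sets[OF fm that] by (subst emeasure_distr[OF fm']) auto
  have inv: "emeasure ?M ((\<lambda>P. g ` P) ` S) = emeasure ?M S"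
    if g: "orthogonal_transformation g" and S: "S \<in> sets grassmannian_borel" for g S
  proof -
    let ?h = "inv g"
    have h: "orthogonal_transformation ?h" by (rule orthogonal_transformation_inv[OF g])
    have lin: "linear ?h" using h orthogonal_transformation_linear by blast
    have bij: "bij g" by (rule orthogonal_transformation_bij[OF g])
    have gh: "g ` ?h ` P = P" "?h ` g ` P = P" for P
      using bij by (simp_all add: image_comp bij_is_inj bij_is_surj surj_iff[THEN iffD1] inj_iff[THEN iffD1])
    have Ss: "S \<subseteq> grassmannian" using sets.sets_into_space[OF S] space_grassmannian_borel by auto
    have eq: "(\<lambda>P. g ` P) ` S = (\<lambda>P. ?h ` P) -` S \<inter> grassmannian"
    proof (intro set_eqI iffI)
      fix P assume "P \<in> (\<lambda>P. g ` P) ` S" then show "P \<in> (\<lambda>P. ?h ` P) -` S \<inter> grassmannian"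
        using gh Ss orthogonal_image_grassmannian[OF g] by auto
    next
      fix P assume "P \<in> (\<lambda>P. ?h ` P) -` S \<inter> grassmannian"
      then show "P \<in> (\<lambda>P. g ` P) ` S" using gh(1)[of P] by (metis IntD1 imageI vimageD)
    qed
    have S': "(\<lambda>P. g ` P) ` S \<in> sets grassmannian_borel"
      unfolding eq using measurable_sets[OF orthogonal_action_measurable[OF h] S] by (simp add: space_grassmannian_borel)
    let ?H = "\<lambda>(x, y). (?h x, ?h y)"
    have Hm: "?H \<in> measurable borel borel"
      unfolding case_prod_beta
      by (intro borel_measurable_continuous_onI continuous_intros linear_continuous_on_compose[OF _ lin])
    have wwh: "gram_vector (?h x) (?h y) = ?h (gram_vector x y)" for x y
      using h lin by (simp add: gram_vector_def linear_diff linear_scale orthogonal_transformation_def)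
    have h0: "?h x = 0 \<longleftrightarrow> x = 0" for x
      using orthogonal_transformation_norm[OF h, of x] by (metis norm_eq_zero)
    have HA: "?H p \<in> independent_pairs \<longleftrightarrow> p \<in> independent_pairs" for p
      by (cases p) (simp add: independent_pairs_def wwh h0 orthogonal_transformation_norm[OF h])
    have sp: "span {?h u, ?h v} = ?h ` span {u, v}" for u v
      using linear_span_image[OF lin, of "{u,v}"] by simp
    have Hf: "f (?H p) = ?h ` f p" if "p \<in> independent_pairs" for p
      using that HA[of p] by (cases p) (simp add: f_def sp)
    have pre: "independent_pairs \<inter> f -` ((\<lambda>P. g ` P) ` S) = ?H -` (independent_pairs \<inter> f -` S)"
      unfolding eq using HA Hf fA by auto
    have m: "independent_pairs \<inter> f -` S \<in> sets borel" using AAb measurable_sets[OF fm S] by auto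
    have "emeasure lborel (independent_pairs \<inter> f -` S) = emeasure (distr lborel lborel ?H) (independent_pairs \<inter> f -` S)"
      by (simp add: lborel_distr_orthogonal_pair[OF h])
    also have "\<dots> = emeasure lborel (?H -` (independent_pairs \<inter> f -` S))"
      using Hm m by (subst emeasure_distr) auto
    finally show ?thesis by (simp only: val[OF S] val[OF S'] pre)
  qed
  show ?thesis unfolding invariant_probability_def using ps inv by (intro exI[of _ ?M]) auto
qed

end

theory Submission
  imports Defs
begin

text \<open>Write \<open>z\<^sub>i = u\<^sub>i + \<i> v\<^sub>i\<close>, let \<open>e\<^sub>i = z\<^sub>i\<^sup>2\<close> be the edges of the quadrilateral, and let
  \<open>x\<^sub>i\<^sub>j\<close> be the oriented area spanned by \<open>e\<^sub>i\<close> and \<open>e\<^sub>j\<close>.  Everything rests on the identity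
  \<open>x\<^sub>i\<^sub>j = 2 (A A\<^sup>T)\<^sub>i\<^sub>j \<Delta>\<^sub>i\<^sub>j\<close> (lemma \<open>turn_eq\<close>): inside a sign cell the \<open>x\<^sub>i\<^sub>j\<close> with
  \<open>i \<noteq> j\<close> are nonzero and have fixed signs, up to one common sign for the orientation of the basis.

  \<^emph>\<open>Shape.\<close>  The sign of \<open>x\<^sub>i\<^sub>,\<^sub>i\<^sub>+\<^sub>1\<close> says whether the polygon turns left or right between the edges
  \<open>i\<close> and \<open>i+1\<close>.  The two products \<open>x\<^sub>1\<^sub>2 x\<^sub>3\<^sub>4\<close> and \<open>x\<^sub>2\<^sub>3 x\<^sub>4\<^sub>1\<close> decide the shape: both positive is
  convex, both negative is self-intersecting, and one of each sign is reflex (lemma \<open>quad_shape\<close>).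

  \<^emph>\<open>Probability.\<close>  Let \<open>a = x\<^sub>1\<^sub>2 x\<^sub>3\<^sub>4\<close>, \<open>b = x\<^sub>1\<^sub>3 x\<^sub>4\<^sub>2\<close>, \<open>c = x\<^sub>1\<^sub>4 x\<^sub>2\<^sub>3\<close>.  The Pluecker relation for
  four vectors of the plane is \<open>a + b + c = 0\<close>, and the coordinate permutation \<open>2 \<rightarrow> 3 \<rightarrow> 4 \<rightarrow> 2\<close>, an
  element of the orthogonal group, moves \<open>a, b, c\<close> cyclically.  Convex means \<open>a > 0 > c\<close>.
  For nonzero reals with sum zero exactly one of \<open>a > 0 > c\<close>, \<open>b > 0 > a\<close>, \<open>c > 0 > b\<close> holds: read
  cyclically, their signs change from minus to plus exactly once.  By invariance these three events have the same
  probability, hence \<open>1/3\<close>.  The same argument with all signs reversed treats the self-intersecting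
  case \<open>a < 0 < c\<close>, and the reflex quadrilaterals are what remains.  This needs that almost every plane has
  all \<open>x\<^sub>i\<^sub>j \<noteq> 0\<close> (lemma \<open>AE_generic\<close>), which follows from invariance alone: a degenerate locus has
  infinitely many rotated copies that meet only in a smaller degenerate locus.

  \<^emph>\<open>Counting.\<close>  The relations \<open>\<Sum>\<^sub>j x\<^sub>i\<^sub>j = 0\<close> leave three free parameters, and then the six numbers
  \<open>x\<^sub>i\<^sub>j\<close> are, up to sign, the pairwise differences of four reals.  So their signs record an ordering of
  four numbers: there are 24 patterns, 12 up to a common sign.
  Given such a pattern, the signs of \<open>(A A\<^sup>T)\<^sub>1\<^sub>j\<close> for \<open>j = 2, 3, 4\<close> are free, because each \<open>z\<^sub>j\<close> can
  be replaced by \<open>- z\<^sub>j\<close> without changing the edges, and they determine all other signs, because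
  the angles of a triple of lines add up (lemma \<open>proj_sign_of_triple\<close>).  Hence there are \<open>12 \<cdot> 8 = 96\<close>
  cells, and each shape accounts for 4 of the 12 patterns.\<close>

section \<open>The area form of the plane\<close>

definition wedge :: "complex \<Rightarrow> complex \<Rightarrow> real" where
  "wedge a b = Re a * Im b - Im a * Re b"

lemma wedge_inner: "wedge a b = (\<i> * a) \<bullet> b"
  by (simp add: wedge_def inner_complex_def)

lemma wedge_self [simp]: "wedge a a = 0"
  by (simp add: wedge_def)

lemma wedge_zero [simp]: "wedge a 0 = 0" "wedge 0 a = 0"
  by (simp_all add: wedge_def)

lemma wedge_linear:
  "wedge a (b + c) = wedge a b + wedge a c" "wedge a (b - c) = wedge a b - wedge a c"
  "wedge (a + b) c = wedge a c + wedge b c" "wedge (a - b) c = wedge a c - wedge b c"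
  "wedge a (- b) = - wedge a b" "wedge (- a) b = - wedge a b"
  "wedge a (t *\<^sub>R b) = t * wedge a b" "wedge (t *\<^sub>R a) b = t * wedge a b"
  by (simp_all add: wedge_def algebra_simps)

lemma wedge_eq_0_scale:
  assumes "wedge a b = 0" "a \<noteq> 0"
  obtains t where "b = t *\<^sub>R a"
proof -
  have "b = Re (b / a) *\<^sub>R a"
  proof -
    have "Im (b / a) = 0" using assms by (simp add: Im_divide wedge_def mult.commute)
    then have "b / a = complex_of_real (Re (b / a))" by (simp add: complex_eq_iff)
    then show ?thesis using assms(2) by (metis nonzero_divide_eq_eq scaleR_conv_of_real)
  qed
  then show thesis by (rule that)
qed

text \<open>The hypothesis puts \<open>c\<close> and \<open>d\<close> strictly on the same side of the line through \<open>a\<close> and \<open>b\<close>.\<close>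

lemma segment_disjoint_from_line:
  assumes "wedge (b - a) (c - a) * wedge (b - a) (d - a) > 0"
  shows "closed_segment a b \<inter> closed_segment c d = {}"
proof (rule ccontr)
  assume "\<not> ?thesis"
  then obtain p where pab: "p \<in> closed_segment a b" and pcd: "p \<in> closed_segment c d" by blast
  from pab obtain t where p: "p = (1 - t) *\<^sub>R a + t *\<^sub>R b" by (auto simp: closed_segment_def)
  from pcd obtain r where r: "0 \<le> r" "r \<le> 1" and p': "p = (1 - r) *\<^sub>R c + r *\<^sub>R d"
    by (auto simp: closed_segment_def)
  have "p - a = t *\<^sub>R (b - a)" unfolding p by (simp add: algebra_simps)
  then have 0: "wedge (b - a) (p - a) = 0" by (simp add: wedge_linear(7) del: scaleR_complex.simps)
  have "p - a = (1 - r) *\<^sub>R (c - a) + r *\<^sub>R (d - a)" unfolding p' by (simp add: algebra_simps)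
  then have "(1 - r) * wedge (b - a) (c - a) + r * wedge (b - a) (d - a) = 0"
    using 0 by (simp add: wedge_linear(1,7))
  moreover have "(1 - r) * w + r * w' > 0" if "w > 0" "w' > 0" for w w' :: real
    using that r by (cases "r = 1") (auto intro: add_pos_nonneg)
  ultimately show False using assms
    by (smt (verit, ccfv_threshold) mult_minus_right zero_less_mult_iff)
qed

text \<open>Each segment has its end points strictly on different sides of the line through the other one.\<close>

lemma segments_cross:
  assumes ab: "wedge (b - a) (c - a) * wedge (b - a) (d - a) < 0"
    and cd: "wedge (d - c) (a - c) * wedge (d - c) (b - c) < 0"
  shows "closed_segment a b \<inter> closed_segment c d \<noteq> {}"
proof -
  have mem: "(w / (w - w')) \<in> {0..1}" if "w * w' < 0" for w w' :: real
    using that by (cases "w > 0") (auto simp: mult_less_0_iff field_simps)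
  \<comment> \<open>The intersection of the two lines, computed from the signed distances of the end points.\<close>
  define k where "k = wedge (b - a) (d - c)"
  define t where "t = wedge (d - c) (a - c) / (wedge (d - c) (a - c) - wedge (d - c) (b - c))"
  define r where "r = wedge (b - a) (c - a) / (wedge (b - a) (c - a) - wedge (b - a) (d - a))"
  have t01: "t \<in> {0..1}" and r01: "r \<in> {0..1}" unfolding t_def r_def by (rule mem ab cd)+
  have dt: "wedge (d - c) (a - c) - wedge (d - c) (b - c) = k"
    and dr: "wedge (b - a) (c - a) - wedge (b - a) (d - a) = - k"
    by (simp_all add: k_def wedge_def algebra_simps)
  have k: "k \<noteq> 0" using ab dr by (auto simp: mult_less_0_iff)
  have "(1 - t) *\<^sub>R a + t *\<^sub>R b = (1 - r) *\<^sub>R c + r *\<^sub>R d"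
  proof -
    have t: "t * k = wedge (d - c) (a - c)" and r: "r * k = - wedge (b - a) (c - a)"
      using k by (simp_all add: t_def r_def dt dr)
    have "k *\<^sub>R ((1 - t) *\<^sub>R a + t *\<^sub>R b) = k *\<^sub>R a + (t * k) *\<^sub>R (b - a)" by (simp add: algebra_simps)
    also have "\<dots> = k *\<^sub>R c + (r * k) *\<^sub>R (d - c)"
      unfolding t r by (simp add: k_def complex_eq_iff wedge_def algebra_simps)
    also have "\<dots> = k *\<^sub>R ((1 - r) *\<^sub>R c + r *\<^sub>R d)" by (simp add: algebra_simps)
    finally show ?thesis using k by (simp only: scaleR_cancel_left) blast
  qed
  then have "(1 - t) *\<^sub>R a + t *\<^sub>R b \<in> closed_segment a b \<inter> closed_segment c d"
    using t01 r01 by (metis (mono_tags, lifting) IntI atLeastAtMost_iff in_segment(1))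
  then show ?thesis by blast
qed

lemma adjacent_segments_meet:
  assumes "wedge (b - a) (c - b) \<noteq> 0"
  shows "closed_segment a b \<inter> closed_segment b c = {b}"
proof (intro set_eqI iffI)
  fix p assume "p \<in> closed_segment a b \<inter> closed_segment b c"
  then obtain t r where p: "p = (1 - t) *\<^sub>R a + t *\<^sub>R b" "p = (1 - r) *\<^sub>R b + r *\<^sub>R c"
    unfolding closed_segment_def by blast
  have ab: "p - b = (t - 1) *\<^sub>R (b - a)" unfolding p(1) by (simp add: algebra_simps)
  have bc: "p - b = r *\<^sub>R (c - b)" unfolding p(2) by (simp add: algebra_simps)
  have "r * wedge (b - a) (c - b) = 0"
    using ab bc by (metis mult_zero_right wedge_linear(7) wedge_self)
  then show "p \<in> {b}" using assms bc by simp
qed simp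

section \<open>The region enclosed by a quadrilateral\<close>

text \<open>The polygon as a set, without a starting point, so that the four vertices can be treated alike.\<close>

definition polygon4 :: "complex \<Rightarrow> complex \<Rightarrow> complex \<Rightarrow> complex \<Rightarrow> complex set" where
  "polygon4 p q r s =
     closed_segment p q \<union> closed_segment q r \<union> closed_segment r s \<union> closed_segment s p"

lemma polygon4_rotate: "polygon4 p q r s = polygon4 q r s p"
  unfolding polygon4_def by blast

text \<open>A polygon that turns the same way at all four vertices is the frontier of the intersection \<open>K\<close> of
  the half-planes to one side of its edges.  Since \<open>K\<close> is convex and bounded, the region inside its
  frontier is its interior.  The factor \<open>\<sigma>\<close> covers both orientations.\<close>

lemma inside_convex_polygon4:
  assumes "\<sigma> * wedge (q - p) (r - q) > 0" "\<sigma> * wedge (r - q) (s - r) > 0"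
    "\<sigma> * wedge (s - r) (p - s) > 0" "\<sigma> * wedge (p - s) (q - p) > 0"
  shows "convex (inside (polygon4 p q r s))"
proof -
  define h where "h a b x = \<sigma> * wedge (b - a) (x - a)" for a b x :: complex
  define H where "H a b = {x. 0 \<le> h a b x}" for a b
  define K where "K = H p q \<inter> H q r \<inter> H r s \<inter> H s p"
  have h_inner: "h a b x = (\<sigma> *\<^sub>R (\<i> * (b - a))) \<bullet> x - (\<sigma> *\<^sub>R (\<i> * (b - a))) \<bullet> a" for a b x
    by (simp add: h_def wedge_inner inner_diff_right algebra_simps)
  have H_halfspace: "H a b = {x. (\<sigma> *\<^sub>R (\<i> * (b - a))) \<bullet> x \<ge> (\<sigma> *\<^sub>R (\<i> * (b - a))) \<bullet> a}" for a b
    by (simp add: H_def h_inner)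
  have pos: "0 < h p q r" "0 < h p q s" "0 < h q r s" "0 < h q r p" "0 < h r s p" "0 < h r s q"
    "0 < h s p q" "0 < h s p r"
    using assms by (simp_all add: h_def wedge_def algebra_simps)
  have self: "h a b a = 0" "h a b b = 0" for a b by (simp_all add: h_def)
  have \<sigma>: "\<sigma> \<noteq> 0" using assms(1) by auto
  have ne: "p \<noteq> q" "q \<noteq> r" "r \<noteq> s" "s \<noteq> p" using assms by auto
  have convex_H: "convex (H a b)" and closed_H: "closed (H a b)" for a b
    unfolding H_halfspace by (rule convex_halfspace_ge closed_halfspace_ge)+
  have interior_H: "interior (H a b) = {x. 0 < h a b x}" if "a \<noteq> b" for a b
    using that \<sigma> unfolding H_halfspace by (subst interior_halfspace_ge) (auto simp: h_inner)
  have convex_K: "convex K" and closed_K: "closed K"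
    unfolding K_def by (intro convex_Int convex_H closed_Int closed_H)+
  have interior_K: "interior K = {x. 0 < h p q x \<and> 0 < h q r x \<and> 0 < h r s x \<and> 0 < h s p x}"
    unfolding K_def interior_Int by (auto simp: interior_H ne)
  have segK: "closed_segment a b \<subseteq> K" if "a \<in> K" "b \<in> K" for a b
    using that convex_K by (rule closed_segment_subset)
  have vK: "p \<in> K" "q \<in> K" "r \<in> K" "s \<in> K"
    using pos by (auto simp: K_def H_def self less_imp_le)
  \<comment> \<open>On the line of an edge the half-planes of the two neighbouring edges cut out exactly that edge.\<close>
  have edge: "x \<in> closed_segment b c"
    if "h b c x = 0" "0 \<le> h a b x" "0 \<le> h c d x" "0 < h b c d" "0 < h a b c" "b \<noteq> c"
       "0 < h c d b" for a b c d x
  proof -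
    have "wedge (c - b) (x - b) = 0" using that(1) \<sigma> by (simp add: h_def)
    then obtain t where t: "x - b = t *\<^sub>R (c - b)" using wedge_eq_0_scale \<open>b \<noteq> c\<close> by (metis eq_iff_diff_eq_0)
    have x: "x = b + t *\<^sub>R (c - b)" using t by (simp add: algebra_simps)
    have "h a b x = t * h a b c" unfolding x h_def wedge_def by (simp add: algebra_simps)
    then have "0 \<le> t" using that by (simp add: zero_le_mult_iff)
    have "h c d x = (1 - t) * h c d b" unfolding x h_def wedge_def by (simp add: algebra_simps)
    then have "t \<le> 1" using that by (simp add: zero_le_mult_iff)
    show ?thesis unfolding closed_segment_def using \<open>0 \<le> t\<close> \<open>t \<le> 1\<close>
      by (auto simp: x algebra_simps intro!: exI[of _ t])
  qed
  have "frontier K = polygon4 p q r s"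
  proof (intro set_eqI iffI)
    fix x assume "x \<in> frontier K"
    then have "x \<in> K" and "x \<notin> interior K"
      using closed_K by (auto simp: frontier_def)
    then have "h p q x = 0 \<or> h q r x = 0 \<or> h r s x = 0 \<or> h s p x = 0"
      unfolding interior_K by (auto simp: K_def H_def)
    moreover have "0 \<le> h p q x" "0 \<le> h q r x" "0 \<le> h r s x" "0 \<le> h s p x"
      using \<open>x \<in> K\<close> by (auto simp: K_def H_def)
    ultimately show "x \<in> polygon4 p q r s"
      unfolding polygon4_def
      using edge[of p q x s r] edge[of q r x p s] edge[of r s x q p] edge[of s p x r q] pos ne by blast
  next
    fix x assume x: "x \<in> polygon4 p q r s"
    have on_line: "h a b x = 0" if "x \<in> closed_segment a b" for a b
    proof -
      obtain t where t: "x = (1 - t) *\<^sub>R a + t *\<^sub>R b" using \<open>x \<in> closed_segment a b\<close>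
        by (auto simp: closed_segment_def)
      show ?thesis unfolding t h_def wedge_def by (simp add: algebra_simps)
    qed
    have "x \<in> K" using x segK vK unfolding polygon4_def by blast
    moreover have "x \<notin> interior K"
      using x on_line[of p q] on_line[of q r] on_line[of r s] on_line[of s p]
      unfolding polygon4_def interior_K by auto
    ultimately show "x \<in> frontier K" using closed_K by (simp add: frontier_def)
  qed
  moreover have "bounded K"
  proof -
    define k where "k = wedge (q - p) (r - q)"
    have k: "\<sigma> * k > 0" using assms(1) by (simp add: k_def)
    define C where "C = h p q p + h q r p + h r s p + h s p p"
    \<comment> \<open>The edges sum to zero, so the four edge functionals have a constant sum; each is therefore
      bounded on \<open>K\<close>, and two independent ones bound the position.\<close>
    have total: "h p q x + h q r x + h r s x + h s p x = C" for x
      by (simp add: C_def h_def wedge_def algebra_simps)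
    have rep: "(\<sigma> * k) *\<^sub>R (x - q) = h p q x *\<^sub>R (r - q) - h q r x *\<^sub>R (q - p)" for x
      by (simp add: k_def h_def wedge_def complex_eq_iff algebra_simps)
    have "norm (x - q) \<le> (C * norm (r - q) + C * norm (q - p)) / (\<sigma> * k)" if "x \<in> K" for x
    proof -
      have nn: "0 \<le> h p q x" "0 \<le> h q r x" "0 \<le> h r s x" "0 \<le> h s p x"
        using \<open>x \<in> K\<close> by (auto simp: K_def H_def)
      then have le: "h p q x \<le> C" "h q r x \<le> C" using total[of x] by linarith+
      have "(\<sigma> * k) * norm (x - q) = norm (h p q x *\<^sub>R (r - q) - h q r x *\<^sub>R (q - p))"
        using k by (simp flip: rep)
      also have "\<dots> \<le> h p q x * norm (r - q) + h q r x * norm (q - p)"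
        using norm_triangle_ineq4[of "h p q x *\<^sub>R (r - q)" "h q r x *\<^sub>R (q - p)"] nn by simp
      also have "\<dots> \<le> C * norm (r - q) + C * norm (q - p)"
        by (intro add_mono mult_right_mono le) auto
      finally show ?thesis using k by (simp add: pos_le_divide_eq mult.commute)
    qed
    then have "K \<subseteq> cball q ((C * norm (r - q) + C * norm (q - p)) / (\<sigma> * k))"
      by (auto simp: dist_norm norm_minus_commute)
    then show ?thesis using bounded_subset bounded_cball by blast
  qed
  ultimately show ?thesis
    using inside_frontier_eq_interior[of K] convex_K by (simp add: convex_interior)
qed

text \<open>A vertex \<open>p\<close> with the opposite turn lies in the interior of the triangle of the other three
  vertices.  If the enclosed region were convex, its closure would contain that triangle, so \<open>p\<close>
  would be an interior point of the region and not a boundary point.\<close>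

lemma inside_reflex_polygon4:
  assumes frontier: "frontier (inside (polygon4 p q r s)) = polygon4 p q r s"
    and "\<sigma> * wedge (p - s) (q - p) < 0" "\<sigma> * wedge (q - p) (r - q) > 0"
      "\<sigma> * wedge (s - r) (p - s) > 0"
  shows "\<not> convex (inside (polygon4 p q r s))"
proof
  let ?I = "inside (polygon4 p q r s)"
  assume convex: "convex ?I"
  have "closed (polygon4 p q r s)" by (simp add: polygon4_def closed_Un)
  then have "open ?I" by (rule open_inside)
  have verts: "{q, r, s} \<subseteq> closure ?I"
    using frontier by (auto simp: frontier_def polygon4_def)
  \<comment> \<open>Up to normalisation, the barycentric coordinates of \<open>p\<close> in the triangle \<open>q, r, s\<close>.\<close>
  define x y z where "x = \<sigma> * wedge (s - r) (p - s)" and "y = - (\<sigma> * wedge (p - s) (q - p))"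
    and "z = \<sigma> * wedge (q - p) (r - q)"
  have pos: "x > 0" "y > 0" "z > 0" using assms by (simp_all add: x_def y_def z_def)
  have sum: "x + y + z = \<sigma> * wedge (r - q) (s - q)"
    by (simp add: x_def y_def z_def wedge_def algebra_simps)
  have "\<not> collinear {q, r, s}"
  proof
    assume "collinear {q, r, s}"
    then have "collinear {r - q, 0, s - q}" using collinear_3[of r q s] by (simp add: insert_commute)
    then have "collinear {0, r - q, s - q}" by (simp add: insert_commute)
    then have "r - q = 0 \<or> s - q = 0 \<or> (\<exists>c. s - q = c *\<^sub>R (r - q))" by (simp add: collinear_lemma)
    then have "wedge (r - q) (s - q) = 0" using wedge_linear(7)[of "r - q" _ "r - q"] by auto
    then show False using sum pos by simp
  qed
  moreover have "(x / (x + y + z)) *\<^sub>R q + (y / (x + y + z)) *\<^sub>R r + (z / (x + y + z)) *\<^sub>R s = p"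
  proof -
    have "x *\<^sub>R q + y *\<^sub>R r + z *\<^sub>R s = (x + y + z) *\<^sub>R p"
      by (simp add: x_def y_def z_def wedge_def complex_eq_iff algebra_simps)
    then have "(1 / (x + y + z)) *\<^sub>R (x *\<^sub>R q + y *\<^sub>R r + z *\<^sub>R s) = p" using pos by simp
    then show ?thesis by (simp add: scaleR_add_right)
  qed
  moreover have "x / (x + y + z) + y / (x + y + z) + z / (x + y + z) = 1"
    using pos by (simp flip: add_divide_distrib)
  moreover have "0 < x / (x + y + z)" "0 < y / (x + y + z)" "0 < z / (x + y + z)"
    using pos by simp_all
  ultimately have "p \<in> interior (convex hull {q, r, s})"
    by (subst interior_convex_hull_3_minimal) auto
  moreover have "convex hull {q, r, s} \<subseteq> closure ?I"
    using verts convex by (intro hull_minimal convex_closure)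
  ultimately have "p \<in> interior (closure ?I)" using interior_mono by blast
  then have "p \<in> ?I" using convex \<open>open ?I\<close> by (simp add: convex_interior_closure interior_open)
  moreover have "p \<in> polygon4 p q r s" by (simp add: polygon4_def)
  ultimately show False by (meson disjoint_iff inside_no_overlap)
qed

section \<open>The shape of a quadrilateral from its turns\<close>

definition edge_wedge :: "complex^4 \<Rightarrow> 4 \<Rightarrow> 4 \<Rightarrow> real" where
  "edge_wedge e i j = wedge (e $ i) (e $ j)"

lemma path_image_quad_path:
  "path_image (quad_path e) = polygon4 (vert1 e) (vert2 e) (vert3 e) (vert4 e)"
  unfolding quad_path_def polygon4_def by (simp add: path_image_join Un_assoc)

lemma edges_as_vertex_differences:
  assumes "(\<Sum>i\<in>UNIV. e $ i) = 0"
  shows "vert2 e - vert1 e = e $ 1" "vert3 e - vert2 e = e $ 2"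
    "vert4 e - vert3 e = e $ 3" "vert1 e - vert4 e = e $ 4"
  using assms by (simp_all add: vert1_def vert2_def vert3_def vert4_def sum_4 add_eq_0_iff)

lemma simple_quad_path:
  assumes e: "(\<Sum>i\<in>UNIV. e $ i) = 0"
    and turns: "edge_wedge e 1 2 \<noteq> 0" "edge_wedge e 2 3 \<noteq> 0" "edge_wedge e 3 4 \<noteq> 0" "edge_wedge e 4 1 \<noteq> 0"
    and "\<not> self_intersecting e"
  shows "embedded e"
proof -
  let ?p = "vert1 e" and ?q = "vert2 e" and ?r = "vert3 e" and ?s = "vert4 e"
  note d = edges_as_vertex_differences[OF e]
  have meet: "closed_segment ?p ?q \<inter> closed_segment ?q ?r = {?q}"
     "closed_segment ?q ?r \<inter> closed_segment ?r ?s = {?r}"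
     "closed_segment ?r ?s \<inter> closed_segment ?s ?p = {?s}"
     "closed_segment ?s ?p \<inter> closed_segment ?p ?q = {?p}"
    using turns by (intro adjacent_segments_meet; simp add: d edge_wedge_def)+
  have opposite: "closed_segment ?p ?q \<inter> closed_segment ?r ?s = {}"
     "closed_segment ?q ?r \<inter> closed_segment ?s ?p = {}"
    using assms(6) by (auto simp: self_intersecting_def)
  have "e $ 1 \<noteq> 0" "e $ 2 \<noteq> 0" "e $ 3 \<noteq> 0" "e $ 4 \<noteq> 0" using turns by (auto simp: edge_wedge_def)
  then have ne: "?p \<noteq> ?q" "?q \<noteq> ?r" "?r \<noteq> ?s" "?s \<noteq> ?p"
    unfolding d[symmetric] by simp_all
  have "arc (linepath ?r ?s +++ linepath ?s ?p)"
    using meet ne by (intro arc_join) (auto intro: arc_linepath)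
  then have "arc (linepath ?q ?r +++ linepath ?r ?s +++ linepath ?s ?p)"
    using meet opposite ne by (intro arc_join) (auto simp: path_image_join intro: arc_linepath)
  then show ?thesis unfolding embedded_def quad_path_def
    using meet opposite ne
    by (intro simple_path_join_loop) (auto simp: path_image_join intro: arc_linepath)
qed

text \<open>Opposite edges are traversed at disjoint times, so a common point is visited twice.\<close>

lemma self_intersecting_not_embedded:
  assumes "self_intersecting e" shows "\<not> embedded e"
proof
  let ?p = "vert1 e" and ?q = "vert2 e" and ?r = "vert3 e" and ?s = "vert4 e"
  assume "embedded e"
  then have simple: "simple_path (quad_path e)" by (simp add: embedded_def)
  have outer: "arc (linepath ?q ?r +++ linepath ?r ?s +++ linepath ?s ?p)"
    "closed_segment ?p ?q \<inter> (closed_segment ?q ?r \<union> (closed_segment ?r ?s \<union> closed_segment ?s ?p)) \<subseteq> {?p, ?q}"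
    using simple simple_path_join_loop_eq[of "linepath ?q ?r +++ linepath ?r ?s +++ linepath ?s ?p" "linepath ?p ?q"]
    unfolding quad_path_def by (simp_all add: path_image_join)
  have middle: "arc (linepath ?q ?r)" "arc (linepath ?r ?s +++ linepath ?s ?p)"
    "closed_segment ?q ?r \<inter> (closed_segment ?r ?s \<union> closed_segment ?s ?p) \<subseteq> {?r}"
    using outer(1) arc_join_eq[of "linepath ?q ?r" "linepath ?r ?s +++ linepath ?s ?p"]
    by (simp_all add: path_image_join)
  have inner: "arc (linepath ?r ?s)" "arc (linepath ?s ?p)" "closed_segment ?r ?s \<inter> closed_segment ?s ?p \<subseteq> {?s}"
    using middle(2) arc_join_eq[of "linepath ?r ?s" "linepath ?s ?p"] by simp_all
  have ne: "?q \<noteq> ?r" "?r \<noteq> ?s" "?s \<noteq> ?p"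
    using arc_distinct_ends[OF middle(1)] arc_distinct_ends[OF inner(1)] arc_distinct_ends[OF inner(2)] by simp_all
  have "?p \<notin> closed_segment ?r ?s" using inner(3) ne(3) by auto
  moreover have "?q \<notin> closed_segment ?r ?s" using middle(3) ne(1) by auto
  ultimately have "closed_segment ?p ?q \<inter> closed_segment ?r ?s = {}" using outer(2) by blast
  moreover have "closed_segment ?q ?r \<inter> closed_segment ?s ?p = {}"
  proof -
    have "?r \<notin> closed_segment ?s ?p" using inner(3) ne(2) by auto
    then show ?thesis using middle(3) by blast
  qed
  ultimately show False using assms by (simp add: self_intersecting_def)
qed

text \<open>The line through an edge separates the end points of the opposite edge exactly if the turns at
  the two ends of the edge itself differ; this decides whether opposite edges cross.  Two turns of each sign in
  alternating position are impossible, because \<open>x\<^sub>1\<^sub>2 + x\<^sub>3\<^sub>4 = x\<^sub>2\<^sub>3 + x\<^sub>4\<^sub>1\<close>.  So without crossing there are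
  either four equal turns or exactly one exceptional one.\<close>

lemma quad_shape:
  assumes e: "(\<Sum>i\<in>UNIV. e $ i) = 0"
    and turns: "edge_wedge e 1 2 \<noteq> 0" "edge_wedge e 2 3 \<noteq> 0" "edge_wedge e 3 4 \<noteq> 0" "edge_wedge e 4 1 \<noteq> 0"
  defines "A \<equiv> edge_wedge e 1 2 * edge_wedge e 3 4" and "B \<equiv> edge_wedge e 2 3 * edge_wedge e 4 1"
  shows "convex_quad e \<longleftrightarrow> A > 0 \<and> B > 0"
    and "reflex e \<longleftrightarrow> A * B < 0"
    and "self_intersecting e \<longleftrightarrow> A < 0 \<and> B < 0"
proof -
  let ?p = "vert1 e" and ?q = "vert2 e" and ?r = "vert3 e" and ?s = "vert4 e"
  let ?t1 = "edge_wedge e 4 1" and ?t2 = "edge_wedge e 1 2"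
    and ?t3 = "edge_wedge e 2 3" and ?t4 = "edge_wedge e 3 4"
  note d = edges_as_vertex_differences[OF e]
  have e4: "e $ 4 = - (e $ 1 + e $ 2 + e $ 3)" using e by (simp add: sum_4 add_eq_0_iff2 add.commute)
  have rel: "?t2 + ?t4 = ?t1 + ?t3"
    by (simp add: edge_wedge_def wedge_def e4 algebra_simps)
  have diag: "?r - ?p = e $ 1 + e $ 2" "?s - ?p = e $ 1 + e $ 2 + e $ 3" "?p - ?r = - (e $ 1 + e $ 2)"
     "?q - ?r = - (e $ 2)" "?s - ?q = e $ 2 + e $ 3" "?p - ?q = - (e $ 1)" "?r - ?s = - (e $ 3)" 
     "?q - ?s = - (e $ 2 + e $ 3)"
    by (simp_all add: vert1_def vert2_def vert3_def vert4_def)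
  have from_line:
    "wedge (?q - ?p) (?r - ?p) = ?t2" "wedge (?q - ?p) (?s - ?p) = ?t1"
    "wedge (?s - ?r) (?p - ?r) = ?t4" "wedge (?s - ?r) (?q - ?r) = ?t3"
    "wedge (?r - ?q) (?s - ?q) = ?t3" "wedge (?r - ?q) (?p - ?q) = ?t2"
    "wedge (?p - ?s) (?q - ?s) = ?t1" "wedge (?p - ?s) (?r - ?s) = ?t4"
    unfolding d diag edge_wedge_def e4 by (simp_all add: wedge_def algebra_simps)
  have AB: "A \<noteq> 0" "B \<noteq> 0" using turns by (auto simp: A_def B_def)
  have first: "closed_segment ?p ?q \<inter> closed_segment ?r ?s \<noteq> {} \<longleftrightarrow> ?t2 * ?t1 < 0 \<and> ?t4 * ?t3 < 0"
    using segments_cross[of ?q ?p ?r ?s] segment_disjoint_from_line[of ?q ?p ?r ?s]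
      segment_disjoint_from_line[of ?s ?r ?p ?q] turns unfolding from_line
    by (metis Int_commute linorder_neqE_linordered_idom mult_eq_0_iff)
  have second: "closed_segment ?q ?r \<inter> closed_segment ?s ?p \<noteq> {} \<longleftrightarrow> ?t3 * ?t2 < 0 \<and> ?t1 * ?t4 < 0"
    using segments_cross[of ?r ?q ?s ?p] segment_disjoint_from_line[of ?r ?q ?s ?p]
      segment_disjoint_from_line[of ?p ?s ?q ?r] turns unfolding from_line
    by (metis Int_commute linorder_neqE_linordered_idom mult_eq_0_iff)
  show self: "self_intersecting e \<longleftrightarrow> A < 0 \<and> B < 0"
    unfolding self_intersecting_def first second A_def B_def mult_less_0_iff
    using rel turns by linarith
  have convex: "convex_region e" if "A > 0" "B > 0"
  proof -
    have "\<exists>\<sigma>. \<sigma> * ?t1 > 0 \<and> \<sigma> * ?t2 > 0 \<and> \<sigma> * ?t3 > 0 \<and> \<sigma> * ?t4 > 0"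
    proof (cases "?t2 > 0")
      case True
      then have "?t4 > 0" using \<open>A > 0\<close> by (simp add: A_def zero_less_mult_iff)
      then have "?t3 > 0 \<and> ?t1 > 0" using \<open>B > 0\<close> True rel by (auto simp: B_def zero_less_mult_iff)
      then show ?thesis using True \<open>?t4 > 0\<close> by (intro exI[of _ 1]) simp
    next
      case False
      then have "?t2 < 0" "?t4 < 0" using \<open>A > 0\<close> by (auto simp: A_def zero_less_mult_iff)
      then have "?t3 < 0 \<and> ?t1 < 0" using \<open>B > 0\<close> rel by (auto simp: B_def zero_less_mult_iff)
      then show ?thesis using \<open>?t2 < 0\<close> \<open>?t4 < 0\<close> by (intro exI[of _ "-1"]) simp
    qed
    then show ?thesis unfolding convex_region_def path_image_quad_path
      using inside_convex_polygon4[of _ ?q ?p ?r ?s] by (auto simp: d edge_wedge_def)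
  qed
  have not_convex: "\<not> convex_region e" if "embedded e" "A * B < 0"
  proof -
    have closed: "pathfinish (quad_path e) = pathstart (quad_path e)" by (simp add: quad_path_def)
    have frontier: "frontier (inside (polygon4 ?p ?q ?r ?s)) = polygon4 ?p ?q ?r ?s"
      using Jordan_inside_outside[OF _ closed] \<open>embedded e\<close>
      by (simp add: embedded_def path_image_quad_path)
    have reflex_at: "\<not> convex (inside (polygon4 ?p ?q ?r ?s))"
      if "polygon4 ?p ?q ?r ?s = polygon4 a b c d" "\<sigma> * wedge (a - d) (b - a) < 0"
        "\<sigma> * wedge (b - a) (c - b) > 0" "\<sigma> * wedge (d - c) (a - d) > 0" for \<sigma> a b c d
      using inside_reflex_polygon4[of a b c d \<sigma>] frontier that by simp
    have rotations: "polygon4 ?p ?q ?r ?s = polygon4 ?p ?q ?r ?s" "polygon4 ?p ?q ?r ?s = polygon4 ?q ?r ?s ?p"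
      "polygon4 ?p ?q ?r ?s = polygon4 ?r ?s ?p ?q" "polygon4 ?p ?q ?r ?s = polygon4 ?s ?p ?q ?r"
      by (metis polygon4_rotate)+
    have "\<exists>\<sigma>. \<sigma> * ?t1 < 0 \<and> \<sigma> * ?t2 > 0 \<and> \<sigma> * ?t4 > 0 \<or> \<sigma> * ?t2 < 0 \<and> \<sigma> * ?t3 > 0 \<and> \<sigma> * ?t1 > 0
      \<or> \<sigma> * ?t3 < 0 \<and> \<sigma> * ?t4 > 0 \<and> \<sigma> * ?t2 > 0 \<or> \<sigma> * ?t4 < 0 \<and> \<sigma> * ?t1 > 0 \<and> \<sigma> * ?t3 > 0"
    proof (cases "A > 0")
      case True
      then have "B < 0" using \<open>A * B < 0\<close> by (simp add: mult_less_0_iff)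
      with True show ?thesis
        by (intro exI[of _ "sgn ?t2"])
           (auto simp: A_def B_def mult_less_0_iff zero_less_mult_iff sgn_if)
    next
      case False
      then have "A < 0" "B > 0" using \<open>A * B < 0\<close> by (auto simp: mult_less_0_iff)
      then show ?thesis
        by (intro exI[of _ "sgn ?t1"])
           (auto simp: A_def B_def mult_less_0_iff zero_less_mult_iff sgn_if)
    qed
    then have "\<not> convex (inside (polygon4 ?p ?q ?r ?s))"
      using reflex_at[OF rotations(1)] reflex_at[OF rotations(2)] reflex_at[OF rotations(3)]
        reflex_at[OF rotations(4)] unfolding d edge_wedge_def by blast
    then show ?thesis by (simp add: convex_region_def path_image_quad_path)
  qed
  have embedded: "embedded e" if "\<not> (A < 0 \<and> B < 0)"
    using simple_quad_path[OF e turns] self that by blast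
  show reflex: "reflex e \<longleftrightarrow> A * B < 0"
    using convex not_convex embedded self self_intersecting_not_embedded[of e] AB
    unfolding reflex_def mult_less_0_iff by (metis linorder_neqE_linordered_idom order_less_asym)
  show "convex_quad e \<longleftrightarrow> A > 0 \<and> B > 0"
    unfolding convex_quad_def reflex self using AB by (auto simp: mult_less_0_iff)
qed

section \<open>Functions of a plane\<close>

definition minor :: "real^4 \<Rightarrow> real^4 \<Rightarrow> 4 \<Rightarrow> 4 \<Rightarrow> real" where
  "minor u v i j = u $ i * v $ j - u $ j * v $ i"

definition proj :: "real^4 \<Rightarrow> real^4 \<Rightarrow> 4 \<Rightarrow> 4 \<Rightarrow> real" where
  "proj u v i j = u $ i * u $ j + v $ i * v $ j"

definition turn :: "real^4 \<Rightarrow> real^4 \<Rightarrow> 4 \<Rightarrow> 4 \<Rightarrow> real" where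
  "turn u v i j = edge_wedge (quad_edges u v) i j"

text \<open>Both \<open>minor\<close> and \<open>proj\<close> are parts of \<open>cnj z\<^sub>i * z\<^sub>j\<close>, and \<open>x\<^sub>i\<^sub>j\<close> is the imaginary part of the
  square of that number.\<close>

lemma turn_eq: "turn u v i j = 2 * proj u v i j * minor u v i j"
  by (simp add: turn_def edge_wedge_def wedge_def quad_edges_Complex Re_power2 Im_power2
      proj_def minor_def power2_eq_square algebra_simps)

lemma turn_antisym: "turn u v j i = - turn u v i j"
  by (simp add: turn_def edge_wedge_def wedge_def)

lemma proj_commute: "proj u v i j = proj u v j i"
  by (simp add: proj_def mult.commute)

definition generic :: "real^4 \<Rightarrow> real^4 \<Rightarrow> bool" where
  "generic u v \<longleftrightarrow> (\<forall>i j. i \<noteq> j \<longrightarrow> turn u v i j \<noteq> 0)"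

lemma stiefel_sum_edges: "(u, v) \<in> stiefel \<Longrightarrow> (\<Sum>i\<in>UNIV. quad_edges u v $ i) = 0"
  using quad_edges_quads by (simp add: quads_def)

text \<open>The change of basis is an orthogonal \<open>2 \<times> 2\<close> matrix: its determinant \<open>s\<close> multiplies the minors,
  and it cancels in the projection matrix.\<close>

lemma orthonormal_basis_change:
  assumes uv: "orthonormal_basis u v P" and xy: "orthonormal_basis x y P"
  obtains s where "s = 1 \<or> s = -1" "\<And>i j. minor x y i j = s * minor u v i j"
    "\<And>i j. proj x y i j = proj u v i j"
proof -
  have o: "u \<bullet> u = 1" "v \<bullet> v = 1" "u \<bullet> v = 0" "v \<bullet> u = 0" and P: "P = span {u, v}"
    using uv by (auto simp: orthonormal_basis_def stiefel_def norm_eq_1 inner_commute)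
  have o': "x \<bullet> x = 1" "y \<bullet> y = 1" "x \<bullet> y = 0" and P': "P = span {x, y}"
    using xy by (auto simp: orthonormal_basis_def stiefel_def norm_eq_1)
  have "x \<in> span {u, v}" "y \<in> span {u, v}"
    unfolding P[symmetric] unfolding P' by (simp_all add: span_base)
  then obtain a b c d where x: "x = a *\<^sub>R u + b *\<^sub>R v" and y: "y = c *\<^sub>R u + d *\<^sub>R v"
    by (meson span_pair_obtain)
  have ab: "a\<^sup>2 + b\<^sup>2 = 1" and cd: "c\<^sup>2 + d\<^sup>2 = 1" and acbd: "a * c + b * d = 0"
    using o' o unfolding x y by (simp_all add: inner_add_left inner_add_right power2_eq_square mult.commute)
  define s where "s = a * d - b * c"
  have c: "c = - s * b" and d: "d = s * a"
    using ab cd acbd unfolding s_def by algebra+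
  have s2: "s\<^sup>2 = 1" using ab cd acbd unfolding s_def by algebra
  then have "s = 1 \<or> s = -1" by (simp add: power2_eq_1_iff)
  moreover have "minor x y i j = s * minor u v i j" for i j
    by (simp add: minor_def x y s_def algebra_simps)
  moreover have "proj x y i j = proj u v i j" for i j
  proof -
    have "proj x y i j = (a\<^sup>2 + s\<^sup>2 * b\<^sup>2) * (u $ i * u $ j) + (b\<^sup>2 + s\<^sup>2 * a\<^sup>2) * (v $ i * v $ j)
        + (a * b - s\<^sup>2 * (a * b)) * (u $ i * v $ j + v $ i * u $ j)"
      by (simp add: proj_def x y c d power2_eq_square algebra_simps)
    then show ?thesis using s2 ab by (simp add: proj_def add.commute)
  qed
  ultimately show thesis by (rule that)
qed

text \<open>Functions of the plane are written as functions of an orthonormal basis; \<open>on_plane\<close> picks a basis, and the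
  choice is immaterial for invariant functions.\<close>

definition basis_invariant :: "(real^4 \<Rightarrow> real^4 \<Rightarrow> 'a) \<Rightarrow> bool" where
  "basis_invariant f \<longleftrightarrow>
     (\<forall>P u v x y. orthonormal_basis u v P \<longrightarrow> orthonormal_basis x y P \<longrightarrow> f x y = f u v)"

definition on_plane :: "(real^4 \<Rightarrow> real^4 \<Rightarrow> 'a) \<Rightarrow> (real^4) set \<Rightarrow> 'a" where
  "on_plane f P = (let b = SOME b. orthonormal_basis (fst b) (snd b) P in f (fst b) (snd b))"

lemma on_plane_eq:
  assumes "basis_invariant f" "orthonormal_basis u v P"
  shows "on_plane f P = f u v"
proof -
  define b where "b = (SOME b. orthonormal_basis (fst b) (snd b) P)"
  have "orthonormal_basis (fst b) (snd b) P"
    unfolding b_def by (rule someI[of _ "(u, v)"]) (simp add: assms)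
  then show ?thesis using assms unfolding on_plane_def basis_invariant_def Let_def b_def[symmetric] by blast
qed

lemma basis_invariantI:
  assumes "\<And>u v x y s. s = 1 \<or> s = (-1::real) \<Longrightarrow> (\<And>i j. minor x y i j = s * minor u v i j) \<Longrightarrow>
      (\<And>i j. proj x y i j = proj u v i j) \<Longrightarrow> f x y = f u v"
  shows "basis_invariant f"
  unfolding basis_invariant_def
proof (intro allI impI)
  fix P u v x y assume "orthonormal_basis u v P" "orthonormal_basis x y P"
  then show "f x y = f u v" by (rule orthonormal_basis_change) (rule assms)
qed

lemma basis_invariant_proj: "basis_invariant (\<lambda>u v. proj u v i j)"
  by (rule basis_invariantI) simp

lemma basis_invariant_minor_sq: "basis_invariant (\<lambda>u v. (minor u v i j)\<^sup>2)"
  by (rule basis_invariantI) auto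

lemma basis_invariant_turns: "basis_invariant (\<lambda>u v. turn u v i j * turn u v k l)"
  by (rule basis_invariantI) (auto simp: turn_eq)

lemma basis_invariant_generic: "basis_invariant generic"
  by (rule basis_invariantI) (auto simp: generic_def turn_eq)

lemma orthonormal_basis_span: "(u, v) \<in> stiefel \<Longrightarrow> orthonormal_basis u v (span {u, v})"
  by (simp add: orthonormal_basis_def)

lemma orthonormal_basis_image:
  assumes "orthogonal_transformation g" "orthonormal_basis u v P"
  shows "orthonormal_basis (g u) (g v) (g ` P)"
proof -
  have "linear g" using assms(1) orthogonal_transformation_linear by blast
  then have "span {g u, g v} = g ` span {u, v}" using linear_span_image[of g "{u,v}"] by simp
  then show ?thesis
    using assms by (auto simp: orthonormal_basis_def stiefel_def orthogonal_transformation_def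
        orthogonal_transformation_norm[OF assms(1)])
qed

text \<open>For an invariant function the preimage of an open set pulls back to a relatively open set of
  orthonormal pairs, so it is one of the generating sets of the Borel structure.\<close>

lemma on_plane_measurable:
  fixes f :: "real^4 \<Rightarrow> real^4 \<Rightarrow> real"
  assumes inv: "basis_invariant f" and cont: "continuous_on stiefel (\<lambda>b. f (fst b) (snd b))"
  shows "on_plane f \<in> borel_measurable grassmannian_borel"
proof (rule borel_measurableI)
  fix S :: "real set" assume "open S"
  let ?U = "on_plane f -` S \<inter> grassmannian"
  have "{(u, v) \<in> stiefel. span {u, v} \<in> ?U} = stiefel \<inter> (\<lambda>b. f (fst b) (snd b)) -` S"
    using on_plane_eq[OF inv orthonormal_basis_span] span_stiefel by auto
  then have "openin (top_of_set stiefel) {(u, v) \<in> stiefel. span {u, v} \<in> ?U}"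
    using continuous_openin_preimage_gen[OF cont \<open>open S\<close>] by simp
  then have "?U \<in> sets grassmannian_borel"
    unfolding sets_grassmannian_borel by (intro sigma_sets.Basic) blast
  then show "on_plane f -` S \<inter> space grassmannian_borel \<in> sets grassmannian_borel"
    by (simp add: space_grassmannian_borel)
qed

lemma measurable_proj: "on_plane (\<lambda>u v. proj u v i j) \<in> borel_measurable grassmannian_borel"
  unfolding proj_def
  by (intro on_plane_measurable basis_invariant_proj[unfolded proj_def] continuous_intros)

lemma measurable_minor_sq: "on_plane (\<lambda>u v. (minor u v i j)\<^sup>2) \<in> borel_measurable grassmannian_borel"
  unfolding minor_def
  by (intro on_plane_measurable basis_invariant_minor_sq[unfolded minor_def] continuous_intros)

lemma measurable_turns:
  "on_plane (\<lambda>u v. turn u v i j * turn u v k l) \<in> borel_measurable grassmannian_borel"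
  by (intro on_plane_measurable basis_invariant_turns; unfold turn_eq proj_def minor_def)
     (intro continuous_intros)

section \<open>Degenerate planes form a null set\<close>

lemma invariant_probability_preimage:
  assumes M: "invariant_probability M" and g: "orthogonal_transformation g"
    and S: "{P \<in> grassmannian. \<phi> P} \<in> sets M"
  shows "{P \<in> grassmannian. \<phi> (g ` P)} \<in> sets M"
    "measure M {P \<in> grassmannian. \<phi> (g ` P)} = measure M {P \<in> grassmannian. \<phi> P}"
proof -
  have sets: "sets M = sets grassmannian_borel" using M by (simp add: invariant_probability_def)
  let ?S = "{P \<in> grassmannian. \<phi> P}" and ?S' = "{P \<in> grassmannian. \<phi> (g ` P)}"
  let ?h = "inv g"
  have h: "orthogonal_transformation ?h" by (rule orthogonal_transformation_inv[OF g])
  have bij: "bij g" by (rule orthogonal_transformation_bij[OF g])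
  have gh: "g ` ?h ` P = P" for P
    using bij by (simp add: image_comp bij_is_surj surj_iff[THEN iffD1])
  have "?S' = (\<lambda>P. g ` P) -` ?S \<inter> space grassmannian_borel"
    using orthogonal_image_grassmannian[OF g] by (auto simp: space_grassmannian_borel)
  then show S': "?S' \<in> sets M"
    using measurable_sets[OF orthogonal_action_measurable[OF g], of ?S] S sets by simp
  have "(\<lambda>P. g ` P) ` ?S' = ?S"
  proof (intro set_eqI iffI)
    fix P assume "P \<in> ?S"
    then have "?h ` P \<in> ?S'" using orthogonal_image_grassmannian[OF h] by (simp add: gh)
    then show "P \<in> (\<lambda>P. g ` P) ` ?S'" by (rule rev_image_eqI) (simp only: gh)
  qed (use orthogonal_image_grassmannian[OF g] in auto)
  moreover have "emeasure M ((\<lambda>P. g ` P) ` ?S') = emeasure M ?S'"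
    using M g S' unfolding invariant_probability_def by blast
  ultimately show "measure M ?S' = measure M ?S" by (simp only: measure_def)
qed

text \<open>Infinitely many sets of the same measure that are disjoint up to a null set must be null sets, since the
  total measure is finite.\<close>

lemma null_of_almost_disjoint_images:
  assumes M: "invariant_probability M" and g: "\<And>k::nat. orthogonal_transformation (g k)"
    and N: "{P \<in> grassmannian. \<phi> P} \<in> sets M" and Z: "{P \<in> grassmannian. \<psi> P} \<in> null_sets M"
    and overlap: "\<And>j k P. j \<noteq> k \<Longrightarrow> P \<in> grassmannian \<Longrightarrow> \<phi> (g j ` P) \<Longrightarrow> \<phi> (g k ` P) \<Longrightarrow> \<psi> P"
  shows "{P \<in> grassmannian. \<phi> P} \<in> null_sets M"
proof -
  interpret prob_space M using M by (simp add: invariant_probability_def)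
  let ?Z = "{P \<in> grassmannian. \<psi> P}" and ?N = "{P \<in> grassmannian. \<phi> P}"
  define A where "A k = {P \<in> grassmannian. \<phi> (g k ` P)} - ?Z" for k
  have pre: "{P \<in> grassmannian. \<phi> (g k ` P)} \<in> sets M"
    "measure M {P \<in> grassmannian. \<phi> (g k ` P)} = measure M ?N" for k
    by (rule invariant_probability_preimage[OF M g N])+
  have sets_A: "range A \<subseteq> sets M" using pre(1) null_setsD2[OF Z] by (auto simp: A_def)
  moreover have "disjoint_family A"
    using overlap by (auto simp: disjoint_family_on_def A_def)
  ultimately have "(\<lambda>k. measure M (A k)) sums measure M (\<Union>k. A k)" by (rule finite_measure_UNION)
  moreover have "measure M (A k) = measure M ?N" for k
    unfolding A_def using measure_Diff_null_set[OF pre(1) Z] pre(2) by simp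
  ultimately have "summable (\<lambda>k::nat. measure M ?N)" by (auto simp: sums_iff)
  then have "measure M ?N = 0" by (simp add: summable_const_iff)
  then show ?thesis using N by (simp add: null_sets_def emeasure_eq_measure)
qed

text \<open>Rotation in the plane of the coordinates \<open>i\<close> and \<open>j\<close> by the angle \<open>arctan k\<close>.  For different \<open>k\<close> the
  new \<open>i\<close>-th coordinates are independent combinations of the old ones, so that two of them vanish only
  if both old coordinates vanish.\<close>

definition rotate_coords :: "4 \<Rightarrow> 4 \<Rightarrow> nat \<Rightarrow> real^4 \<Rightarrow> real^4" where
  "rotate_coords i j k x = (let c = 1 / sqrt (1 + (real k)\<^sup>2); s = real k / sqrt (1 + (real k)\<^sup>2) in
     \<chi> m. if m = i then c * x $ i + s * x $ j else if m = j then c * x $ j - s * x $ i else x $ m)"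

lemma UNIV_4_distinct:
  fixes i j k l :: 4
  assumes "distinct [i, j, k, l]"
  shows "UNIV = {i, j, k, l}"
proof -
  have "card {i, j, k, l} = CARD(4)" using assms by simp
  then show ?thesis using card_subset_eq[of UNIV "{i, j, k, l}"] by simp
qed

lemma obtain_distinct_4:
  fixes i j :: 4 assumes "i \<noteq> j"
  obtains k l where "distinct [i, j, k, l]"
proof -
  have "card (- {i, j}) = 2" using assms by (simp add: Compl_eq_Diff_UNIV card_Diff_subset)
  then obtain k l where "- {i, j} = {k, l}" "k \<noteq> l" by (auto simp: card_2_iff)
  then have "distinct [i, j, k, l]" using assms by auto
  then show thesis by (rule that)
qed

lemma inner_4_distinct:
  fixes i j k l :: 4
  assumes "distinct [i, j, k, l]"
  shows "x \<bullet> y = x $ i * y $ i + x $ j * y $ j + x $ k * y $ k + x $ l * y $ l"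
  unfolding inner_vec_def UNIV_4_distinct[OF assms] using assms by simp

lemma orthogonal_rotate_coords:
  assumes "i \<noteq> j" shows "orthogonal_transformation (rotate_coords i j n)"
proof -
  define c s where "c = 1 / sqrt (1 + (real n)\<^sup>2)" and "s = real n / sqrt (1 + (real n)\<^sup>2)"
  have "1 + (real n)\<^sup>2 > 0" by (simp add: add_pos_nonneg)
  then have cs: "c\<^sup>2 + s\<^sup>2 = 1" by (simp add: c_def s_def power_divide flip: add_divide_distrib)
  have rot: "rotate_coords i j n x $ m = (if m = i then c * x $ i + s * x $ j
      else if m = j then c * x $ j - s * x $ i else x $ m)" for x m
    by (simp add: rotate_coords_def c_def s_def Let_def)
  obtain k l where d: "distinct [i, j, k, l]" using obtain_distinct_4[OF assms] .
  then have ne: "j \<noteq> i" "k \<noteq> i" "l \<noteq> i" "k \<noteq> j" "l \<noteq> j" by auto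
  have "rotate_coords i j n x \<bullet> rotate_coords i j n y = x \<bullet> y" for x y
  proof -
    have "rotate_coords i j n x \<bullet> rotate_coords i j n y =
       (c\<^sup>2 + s\<^sup>2) * (x $ i * y $ i + x $ j * y $ j) + x $ k * y $ k + x $ l * y $ l"
      unfolding inner_4_distinct[OF d] rot by (simp add: ne power2_eq_square algebra_simps)
    then show ?thesis by (simp add: cs inner_4_distinct[OF d])
  qed
  moreover have "linear (rotate_coords i j n)"
    by (intro linearI) (auto simp: vec_eq_iff rot algebra_simps)
  ultimately show ?thesis by (simp add: orthogonal_transformation_def)
qed

lemma rotate_coords_nth:
  "rotate_coords i j n x $ i = (x $ i + real n * x $ j) / sqrt (1 + (real n)\<^sup>2)"
  "m \<noteq> i \<Longrightarrow> m \<noteq> j \<Longrightarrow> rotate_coords i j n x $ m = x $ m"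
  by (simp_all add: rotate_coords_def Let_def add_divide_distrib)

lemma sqrt_one_plus_sq_pos: "sqrt (1 + (real n)\<^sup>2) > 0"
  by (simp add: add_pos_nonneg)

lemma rotations_independent:
  assumes "m \<noteq> n" "a + real m * b = 0" "a + real n * b = 0"
  shows "a = 0" "b = 0"
proof -
  have "(real m - real n) * b = 0" using assms(2,3) by (simp only: left_diff_distrib)
  then show "b = 0" using assms(1) by simp
  then show "a = 0" using assms(2) by simp
qed

lemma divide_sqrt_one_plus_sq_eq_0: "a / sqrt (1 + (real n)\<^sup>2) = 0 \<longleftrightarrow> a = 0"
  using sqrt_one_plus_sq_pos[of n] by (simp only: divide_eq_0_iff) auto

lemma one_plus_sq_neq_0: "1 + (real n)\<^sup>2 \<noteq> 0"
  using zero_le_power2[of "real n"] by linarith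

lemma rotated_pair:
  fixes x y :: "real^4"
  assumes "m \<noteq> n" "rotate_coords i j m x $ i = 0" "rotate_coords i j n x $ i = 0"
  shows "x $ i = 0" "x $ j = 0"
  using rotations_independent[OF assms(1), of "x $ i" "x $ j"] assms(2,3)
  by (simp_all only: rotate_coords_nth divide_sqrt_one_plus_sq_eq_0)

lemma proj_diag_eq_0: "proj u v i i = 0 \<longleftrightarrow> u $ i = 0 \<and> v $ i = 0"
  by (simp add: proj_def sum_squares_eq_zero_iff)

lemmas on_plane_simps =
  on_plane_eq[OF basis_invariant_proj] on_plane_eq[OF basis_invariant_minor_sq]

context
  fixes M :: "(real^4) set measure"
  assumes M: "invariant_probability M"
begin

lemma sets_invariant: "sets M = sets grassmannian_borel"
  using M by (simp add: invariant_probability_def)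

lemma space_invariant: "space M = grassmannian"
  using sets_eq_imp_space_eq[OF sets_invariant] by (simp add: space_grassmannian_borel)

lemma level_sets_invariant:
  fixes f :: "(real^4) set \<Rightarrow> real"
  assumes "f \<in> borel_measurable grassmannian_borel"
  shows "{P \<in> grassmannian. f P = 0} \<in> sets M" "{P \<in> grassmannian. f P > 0} \<in> sets M"
    "{P \<in> grassmannian. f P < 0} \<in> sets M"
proof -
  have f: "f \<in> borel_measurable M" using assms measurable_cong_sets[OF sets_invariant refl] by blast
  show "{P \<in> grassmannian. f P = 0} \<in> sets M" "{P \<in> grassmannian. f P > 0} \<in> sets M"
    "{P \<in> grassmannian. f P < 0} \<in> sets M"
    unfolding space_invariant[symmetric] using f by measurable
qed

lemma sets_Collect_invariant:
  assumes "{P \<in> grassmannian. \<phi> P} \<in> sets M" "{P \<in> grassmannian. \<psi> P} \<in> sets M"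
  shows "{P \<in> grassmannian. \<phi> P \<and> \<psi> P} \<in> sets M"
proof -
  have "{P \<in> grassmannian. \<phi> P \<and> \<psi> P} = {P \<in> grassmannian. \<phi> P} \<inter> {P \<in> grassmannian. \<psi> P}" by blast
  then show ?thesis using assms by auto
qed

text \<open>A chain of loci, each null by rotating in one coordinate plane: two rotated copies of a locus meet
  only in loci that are already known to be null.  It starts with three vanishing rows, which is impossible for an orthonormal
  pair of vectors.\<close>

lemma null_two_zero_rows:
  assumes "i \<noteq> j"
  shows "{P \<in> grassmannian. on_plane (\<lambda>u v. proj u v i i) P = 0 \<and> on_plane (\<lambda>u v. proj u v j j) P = 0}
    \<in> null_sets M"
proof -
  obtain k l where d: "distinct [i, j, k, l]" using obtain_distinct_4[OF assms] .
  then have ne: "i \<noteq> j" "j \<noteq> i" "i \<noteq> k" "j \<noteq> k" by auto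
  show ?thesis
  proof (rule null_of_almost_disjoint_images[OF M, where g = "rotate_coords j k" and \<psi> = "\<lambda>P. False"])
    fix m n :: nat and P
    assume mn: "m \<noteq> n" and P: "P \<in> grassmannian"
      and z: "on_plane (\<lambda>u v. proj u v i i) (rotate_coords j k m ` P) = 0 \<and>
           on_plane (\<lambda>u v. proj u v j j) (rotate_coords j k m ` P) = 0"
        "on_plane (\<lambda>u v. proj u v i i) (rotate_coords j k n ` P) = 0 \<and>
           on_plane (\<lambda>u v. proj u v j j) (rotate_coords j k n ` P) = 0"
    obtain u v where uv: "orthonormal_basis u v P" using plane_has_orthonormal_basis[OF P] .
    note rot = orthonormal_basis_image[OF orthogonal_rotate_coords[OF ne(4)] uv]
    have "u $ i = 0" "v $ i = 0" "u $ j = 0" "v $ j = 0" "u $ k = 0" "v $ k = 0"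
      using z ne rotated_pair[OF mn, of j k u] rotated_pair[OF mn, of j k v]
      by (simp_all add: on_plane_simps[OF rot] proj_diag_eq_0 rotate_coords_nth(2))
    moreover have "u \<bullet> u = 1" "v \<bullet> v = 1" "u \<bullet> v = 0"
      using uv by (auto simp: orthonormal_basis_def stiefel_def norm_eq_1)
    ultimately show False by (auto simp: inner_4_distinct[OF d])
  qed (use orthogonal_rotate_coords ne in
      \<open>auto intro!: sets_Collect_invariant level_sets_invariant measurable_proj\<close>)
qed

lemma null_zero_row: "{P \<in> grassmannian. on_plane (\<lambda>u v. proj u v i i) P = 0} \<in> null_sets M"
proof -
  obtain j where ne: "i \<noteq> j" using exhaust_4[of i] by (metis zero_neq_one num1_eq1 zero_neq_numeral one_neq_zero)
  show ?thesis
  proof (rule null_of_almost_disjoint_images[OF M, where g = "rotate_coords i j", OF _ _ null_two_zero_rows[OF ne]])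
    fix m n :: nat and P
    assume mn: "m \<noteq> n" and P: "P \<in> grassmannian"
      and z: "on_plane (\<lambda>u v. proj u v i i) (rotate_coords i j m ` P) = 0"
        "on_plane (\<lambda>u v. proj u v i i) (rotate_coords i j n ` P) = 0"
    obtain u v where uv: "orthonormal_basis u v P" using plane_has_orthonormal_basis[OF P] .
    note rot = orthonormal_basis_image[OF orthogonal_rotate_coords[OF ne] uv]
    show "on_plane (\<lambda>u v. proj u v i i) P = 0 \<and> on_plane (\<lambda>u v. proj u v j j) P = 0"
      using z rotated_pair[OF mn, of i j u] rotated_pair[OF mn, of i j v]
      by (simp add: on_plane_simps[OF rot] on_plane_simps[OF uv] proj_diag_eq_0)
  qed (use orthogonal_rotate_coords ne in \<open>auto intro!: level_sets_invariant measurable_proj\<close>)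
qed

text \<open>If the \<open>i\<close>-th row is parallel to all other rows then it vanishes, because the matrix has rank two.\<close>

lemma null_two_zero_minors:
  assumes "distinct [i, j, k]"
  shows "{P \<in> grassmannian. on_plane (\<lambda>u v. (minor u v i j)\<^sup>2) P = 0 \<and>
      on_plane (\<lambda>u v. (minor u v i k)\<^sup>2) P = 0} \<in> null_sets M"
proof -
  obtain l where d: "distinct [i, j, k, l]"
  proof -
    obtain a b where "distinct [i, j, a, b]" using obtain_distinct_4[of i j] assms by auto
    then show thesis using that[of a] that[of b] assms by auto
  qed
  then have ne: "i \<noteq> k" "i \<noteq> l" "j \<noteq> k" "j \<noteq> l" "k \<noteq> l" by auto
  have rotated_minor: "minor (rotate_coords k l n u) (rotate_coords k l n v) i k
      = (minor u v i k + real n * minor u v i l) / sqrt (1 + (real n)\<^sup>2)"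
    "minor (rotate_coords k l n u) (rotate_coords k l n v) i j = minor u v i j" for n u v
    using ne by (simp_all add: minor_def rotate_coords_nth diff_divide_distrib algebra_simps flip: add_divide_distrib)
  show ?thesis
  proof (rule null_of_almost_disjoint_images[OF M, where g = "rotate_coords k l", OF _ _ null_zero_row[of i]])
    fix m n :: nat and P
    assume mn: "m \<noteq> n" and P: "P \<in> grassmannian"
      and z: "on_plane (\<lambda>u v. (minor u v i j)\<^sup>2) (rotate_coords k l m ` P) = 0 \<and>
          on_plane (\<lambda>u v. (minor u v i k)\<^sup>2) (rotate_coords k l m ` P) = 0"
        "on_plane (\<lambda>u v. (minor u v i j)\<^sup>2) (rotate_coords k l n ` P) = 0 \<and>
          on_plane (\<lambda>u v. (minor u v i k)\<^sup>2) (rotate_coords k l n ` P) = 0"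
    obtain u v where uv: "orthonormal_basis u v P" using plane_has_orthonormal_basis[OF P] .
    note rot = orthonormal_basis_image[OF orthogonal_rotate_coords[OF ne(5)] uv]
    have ij: "minor u v i j = 0" and sums: "minor u v i k + real m * minor u v i l = 0"
       "minor u v i k + real n * minor u v i l = 0"
      using z by (simp_all add: on_plane_simps[OF rot] rotated_minor one_plus_sq_neq_0)
    note ij rotations_independent[OF mn sums]
    then have "u $ i * v $ m - u $ m * v $ i = 0" for m
      using UNIV_4_distinct[OF d] by (auto simp: minor_def)
    then have par: "u $ i *\<^sub>R v = v $ i *\<^sub>R u" by (simp add: vec_eq_iff mult.commute)
    have o: "u \<bullet> u = 1" "v \<bullet> v = 1" "u \<bullet> v = 0"
      using uv by (auto simp: orthonormal_basis_def stiefel_def norm_eq_1)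
    have "u $ i = 0" "v $ i = 0"
      using arg_cong[OF par, of "\<lambda>x. x \<bullet> v"] arg_cong[OF par, of "\<lambda>x. u \<bullet> x"] o by simp_all
    then show "on_plane (\<lambda>u v. proj u v i i) P = 0"
      by (simp add: on_plane_simps[OF uv] proj_diag_eq_0)
  qed (use orthogonal_rotate_coords ne in
      \<open>auto intro!: sets_Collect_invariant level_sets_invariant measurable_minor_sq\<close>)
qed

lemma null_zero_minor:
  assumes "i \<noteq> j"
  shows "{P \<in> grassmannian. on_plane (\<lambda>u v. (minor u v i j)\<^sup>2) P = 0} \<in> null_sets M"
proof -
  obtain k l where "distinct [i, j, k, l]" using obtain_distinct_4[OF assms] .
  then have d: "distinct [i, j, k]" and ne: "i \<noteq> k" "j \<noteq> k" by auto
  have rotated_minor: "minor (rotate_coords j k n u) (rotate_coords j k n v) i j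
      = (minor u v i j + real n * minor u v i k) / sqrt (1 + (real n)\<^sup>2)" for n u v
    using ne assms by (simp add: minor_def rotate_coords_nth diff_divide_distrib algebra_simps flip: add_divide_distrib)
  show ?thesis
  proof (rule null_of_almost_disjoint_images[OF M, where g = "rotate_coords j k", OF _ _ null_two_zero_minors[OF d]])
    fix m n :: nat and P
    assume mn: "m \<noteq> n" and P: "P \<in> grassmannian"
      and z: "on_plane (\<lambda>u v. (minor u v i j)\<^sup>2) (rotate_coords j k m ` P) = 0"
        "on_plane (\<lambda>u v. (minor u v i j)\<^sup>2) (rotate_coords j k n ` P) = 0"
    obtain u v where uv: "orthonormal_basis u v P" using plane_has_orthonormal_basis[OF P] .
    note rot = orthonormal_basis_image[OF orthogonal_rotate_coords[OF ne(2)] uv]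
    have sums: "minor u v i j + real m * minor u v i k = 0" "minor u v i j + real n * minor u v i k = 0"
      using z by (simp_all add: on_plane_simps[OF rot] rotated_minor one_plus_sq_neq_0)
    show "on_plane (\<lambda>u v. (minor u v i j)\<^sup>2) P = 0 \<and> on_plane (\<lambda>u v. (minor u v i k)\<^sup>2) P = 0"
      using rotations_independent[OF mn sums] by (simp add: on_plane_simps[OF uv])
  qed (use orthogonal_rotate_coords ne in \<open>auto intro!: level_sets_invariant measurable_minor_sq\<close>)
qed

text \<open>If the rows \<open>j\<close> and \<open>k\<close> are both orthogonal to the \<open>i\<close>-th row, then this row vanishes or they are parallel.\<close>

lemma null_zero_proj:
  assumes "i \<noteq> j"
  shows "{P \<in> grassmannian. on_plane (\<lambda>u v. proj u v i j) P = 0} \<in> null_sets M"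
proof -
  obtain k l where "distinct [i, j, k, l]" using obtain_distinct_4[OF assms] .
  then have ne: "i \<noteq> k" "j \<noteq> k" by auto
  have rotated_proj: "proj (rotate_coords j k n u) (rotate_coords j k n v) i j
      = (proj u v i j + real n * proj u v i k) / sqrt (1 + (real n)\<^sup>2)" for n u v
    using ne assms by (simp add: proj_def rotate_coords_nth algebra_simps flip: add_divide_distrib)
  have "{P \<in> grassmannian. on_plane (\<lambda>u v. proj u v i i) P = 0 \<or> on_plane (\<lambda>u v. (minor u v j k)\<^sup>2) P = 0}
      \<in> null_sets M"
    using null_sets.Un[OF null_zero_row[of i] null_zero_minor[OF ne(2)]] by (simp add: Collect_disj_eq[symmetric] conj_disj_distribL[symmetric] Un_def)
  then show ?thesis
  proof (rule null_of_almost_disjoint_images[OF M, where g = "rotate_coords j k", rotated 2])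
    fix m n :: nat and P
    assume mn: "m \<noteq> n" and P: "P \<in> grassmannian"
      and z: "on_plane (\<lambda>u v. proj u v i j) (rotate_coords j k m ` P) = 0"
        "on_plane (\<lambda>u v. proj u v i j) (rotate_coords j k n ` P) = 0"
    obtain u v where uv: "orthonormal_basis u v P" using plane_has_orthonormal_basis[OF P] .
    note rot = orthonormal_basis_image[OF orthogonal_rotate_coords[OF ne(2)] uv]
    have sums: "proj u v i j + real m * proj u v i k = 0" "proj u v i j + real n * proj u v i k = 0"
      using z by (simp_all add: on_plane_simps[OF rot] rotated_proj one_plus_sq_neq_0)
    note rotations_independent[OF mn sums]
    moreover have "u $ i * minor u v j k = v $ k * proj u v i j - v $ j * proj u v i k"
      "v $ i * minor u v j k = u $ j * proj u v i k - u $ k * proj u v i j"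
      by (simp_all add: minor_def proj_def algebra_simps)
    ultimately show "on_plane (\<lambda>u v. proj u v i i) P = 0 \<or> on_plane (\<lambda>u v. (minor u v j k)\<^sup>2) P = 0"
      by (auto simp: on_plane_simps[OF uv] proj_diag_eq_0)
  qed (use orthogonal_rotate_coords ne in \<open>auto intro!: level_sets_invariant measurable_proj\<close>)
qed

lemma AE_generic: "AE P in M. on_plane generic P"
proof -
  let ?Z = "\<lambda>i j. {P \<in> grassmannian. on_plane (\<lambda>u v. proj u v i j) P = 0} \<union>
    {P \<in> grassmannian. on_plane (\<lambda>u v. (minor u v i j)\<^sup>2) P = 0}"
  have "(\<Union>(i, j) \<in> {(i, j). i \<noteq> j}. ?Z i j) \<in> null_sets M"
    by (intro null_sets_UN' countable_finite) (auto intro!: null_sets.Un null_zero_proj null_zero_minor)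
  then show ?thesis
  proof (rule AE_I', intro subsetI)
    fix P assume "P \<in> {P \<in> space M. \<not> on_plane generic P}"
    then have P: "P \<in> grassmannian" "\<not> on_plane generic P" by (auto simp: space_invariant)
    obtain u v where uv: "orthonormal_basis u v P" using plane_has_orthonormal_basis[OF P(1)] .
    obtain i j where "i \<noteq> j" "turn u v i j = 0"
      using P(2) on_plane_eq[OF basis_invariant_generic uv] by (auto simp: generic_def)
    then have "P \<in> ?Z i j" using P(1) by (auto simp: turn_eq on_plane_simps[OF uv])
    then show "P \<in> (\<Union>(i, j) \<in> {(i, j). i \<noteq> j}. ?Z i j)" using \<open>i \<noteq> j\<close> by blast
  qed
qed

end

section \<open>The probabilities\<close>

abbreviation turn_product :: "4 \<Rightarrow> 4 \<Rightarrow> 4 \<Rightarrow> 4 \<Rightarrow> (real^4) set \<Rightarrow> real" where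
  "turn_product i j k l \<equiv> on_plane (\<lambda>u v. turn u v i j * turn u v k l)"

lemmas turn_product_eq = on_plane_eq[OF basis_invariant_turns]

lemma turn_row_sum:
  assumes "(u, v) \<in> stiefel"
  shows "turn u v i 1 + turn u v i 2 + turn u v i 3 + turn u v i 4 = 0"
proof -
  have "quad_edges u v $ 4 = - (quad_edges u v $ 1 + quad_edges u v $ 2 + quad_edges u v $ 3)"
    using stiefel_sum_edges[OF assms] by (simp add: sum_4 add_eq_0_iff2 add.commute)
  then show ?thesis by (simp add: turn_def edge_wedge_def wedge_linear)
qed

text \<open>The Pluecker relation for four vectors in the plane.\<close>

lemma turn_product_pluecker:
  assumes "P \<in> grassmannian"
  shows "turn_product 1 2 3 4 P + turn_product 1 3 4 2 P + turn_product 1 4 2 3 P = 0"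
proof -
  obtain u v where uv: "orthonormal_basis u v P" using plane_has_orthonormal_basis[OF assms] .
  show ?thesis
    unfolding turn_product_eq[OF uv] by (simp add: turn_def edge_wedge_def wedge_def algebra_simps)
qed

lemma plane_shape:
  assumes P: "P \<in> grassmannian" and gen: "on_plane generic P"
  defines "a \<equiv> turn_product 1 2 3 4 P" and "c \<equiv> turn_product 1 4 2 3 P"
  shows "(\<forall>e\<in>quad_of_plane P. convex_quad e) \<longleftrightarrow> a > 0 \<and> c < 0"
    and "(\<forall>e\<in>quad_of_plane P. reflex e) \<longleftrightarrow> a * c > 0"
    and "(\<forall>e\<in>quad_of_plane P. self_intersecting e) \<longleftrightarrow> a < 0 \<and> c > 0"
proof -
  have shape: "convex_quad e \<longleftrightarrow> a > 0 \<and> c < 0" "reflex e \<longleftrightarrow> a * c > 0"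
     "self_intersecting e \<longleftrightarrow> a < 0 \<and> c > 0" if e_in: "e \<in> quad_of_plane P" for e
  proof -
    obtain u v where uv: "orthonormal_basis u v P" and e: "e = quad_edges u v"
      using e_in by (auto simp: quad_of_plane_def)
    have g: "generic u v" using gen on_plane_eq[OF basis_invariant_generic uv] by simp
    have sum: "(\<Sum>i\<in>UNIV. e $ i) = 0"
      using uv stiefel_sum_edges by (simp add: e orthonormal_basis_def)
    have turns: "edge_wedge e 1 2 \<noteq> 0" "edge_wedge e 2 3 \<noteq> 0" "edge_wedge e 3 4 \<noteq> 0" "edge_wedge e 4 1 \<noteq> 0"
      using g by (auto simp: generic_def turn_def e)
    have c: "edge_wedge e 2 3 * edge_wedge e 4 1 = - c"
      unfolding c_def turn_product_eq[OF uv] by (simp add: turn_def e edge_wedge_def wedge_def algebra_simps)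
    have a: "edge_wedge e 1 2 * edge_wedge e 3 4 = a"
      unfolding a_def turn_product_eq[OF uv] by (simp add: turn_def e)
    show "convex_quad e \<longleftrightarrow> a > 0 \<and> c < 0" "reflex e \<longleftrightarrow> a * c > 0"
     "self_intersecting e \<longleftrightarrow> a < 0 \<and> c > 0"
      using quad_shape[OF sum turns] unfolding a c by simp_all
  qed
  obtain u v where "orthonormal_basis u v P" using plane_has_orthonormal_basis[OF P] .
  then have "quad_of_plane P \<noteq> {}" by (auto simp: quad_of_plane_def)
  then show "(\<forall>e\<in>quad_of_plane P. convex_quad e) \<longleftrightarrow> a > 0 \<and> c < 0"
    "(\<forall>e\<in>quad_of_plane P. reflex e) \<longleftrightarrow> a * c > 0"
    "(\<forall>e\<in>quad_of_plane P. self_intersecting e) \<longleftrightarrow> a < 0 \<and> c > 0"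
    using shape by auto
qed

text \<open>The shape of a quadrilateral agrees with the sign condition \<open>\<phi>\<close> for generic planes only.  The set of planes of
  the given shape thus differs from a Borel set within a null set, hence is measurable for
  the completed measure, with the same value.\<close>

lemma symmetric_measure_of_class:
  assumes M: "invariant_probability M" and \<phi>: "{P \<in> grassmannian. \<phi> P} \<in> sets M"
    and shape: "\<And>P. P \<in> grassmannian \<Longrightarrow> on_plane generic P \<Longrightarrow> (\<forall>e\<in>quad_of_plane P. \<kappa> e) \<longleftrightarrow> \<phi> P"
  shows "measure (symmetric_measure M) {q \<in> quad_classes. \<forall>e\<in>q. \<kappa> e} = measure M {P \<in> grassmannian. \<phi> P}"
proof -
  define S where "S = {P \<in> grassmannian. \<phi> P}"
  define C where "C = {q \<in> quad_classes. \<forall>e\<in>q. \<kappa> e}"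
  define T where "T = quad_of_plane -` C \<inter> space M"
  let ?\<G> = "{A. A \<subseteq> quad_classes \<and> quad_of_plane -` A \<inter> space M \<in> sets (completion M)}"
  have space: "space M = grassmannian" by (rule space_invariant[OF M])
  have T: "P \<in> T \<longleftrightarrow> P \<in> grassmannian \<and> (\<forall>e\<in>quad_of_plane P. \<kappa> e)" for P
    using quad_of_plane_in_quad_classes by (auto simp: space T_def C_def)
  have S: "S \<in> sets M" using \<phi> by (simp add: S_def)
  obtain N where N: "{P \<in> space M. \<not> on_plane generic P} \<subseteq> N" "N \<in> null_sets M"
    using AE_generic[OF M] unfolding eventually_ae_filter by blast
  have agree: "P \<in> T \<longleftrightarrow> P \<in> S" if "P \<notin> N" for P
  proof (cases "P \<in> grassmannian")
    case True
    then have "on_plane generic P" using N(1) that by (auto simp: space)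
    then show ?thesis using True shape[OF True] by (simp add: T S_def)
  qed (simp add: T S_def)
  have "T \<inter> N \<in> sets (completion M)" by (rule sets_completionI_sub[OF N(2)]) blast
  moreover have "S - N \<in> sets (completion M)" using S N(2) by (intro sets_completionI_sets) auto
  ultimately have "(S - N) \<union> (T \<inter> N) \<in> sets (completion M)" by (rule sets.Un[rotated])
  moreover have "(S - N) \<union> (T \<inter> N) = T" using agree by auto
  ultimately have meas_T: "T \<in> sets (completion M)" by simp
  have "AE P in M. P \<in> T \<longleftrightarrow> P \<in> S"
    using N(2) agree by (intro AE_I'[of N]) auto
  then have "AE P in completion M. P \<in> T \<longleftrightarrow> P \<in> S" by (rule AE_completion)
  then have "measure (completion M) T = measure (completion M) S"
    using meas_T S by (intro measure_eq_AE) auto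
  moreover have "quad_of_plane \<in> measurable (completion M) (sigma quad_classes ?\<G>)"
    using quad_of_plane_in_quad_classes by (intro measurable_measure_of) (auto simp: space)
  moreover have "C \<in> sets (sigma quad_classes ?\<G>)"
    using meas_T by (subst sets_measure_of) (auto simp: T_def C_def)
  ultimately show ?thesis
    unfolding symmetric_measure_def C_def[symmetric] S_def[symmetric]
    using S by (simp add: measure_distr T_def[symmetric])
qed

text \<open>The three events have the same probability, and almost surely exactly one of them happens.\<close>

lemma one_third_by_three_cycle:
  assumes M: "invariant_probability M" and g: "orthogonal_transformation g"
    and \<phi>: "{P \<in> grassmannian. \<phi> P} \<in> sets M"
    and once: "AE P in M. \<phi> P \<and> \<not> \<phi> (g ` P) \<and> \<not> \<phi> (g ` g ` P) \<or> \<not> \<phi> P \<and> \<phi> (g ` P) \<and> \<not> \<phi> (g ` g ` P)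
       \<or> \<not> \<phi> P \<and> \<not> \<phi> (g ` P) \<and> \<phi> (g ` g ` P)"
  shows "measure M {P \<in> grassmannian. \<phi> P} = 1 / 3"
proof -
  interpret prob_space M using M by (simp add: invariant_probability_def)
  let ?A = "\<lambda>\<psi>. {P \<in> grassmannian. \<psi> P}"
  note space = space_invariant[OF M]
  note m1 = invariant_probability_preimage[OF M g \<phi>]
  note m2 = invariant_probability_preimage[OF M g m1(1)]
  let ?f = "\<lambda>P. indicator (?A \<phi>) P + indicator (?A (\<lambda>P. \<phi> (g ` P))) P + indicator (?A (\<lambda>P. \<phi> (g ` g ` P))) P :: real"
  have "AE P in M. ?f P = 1"
    using once AE_space by eventually_elim (auto simp: indicator_def space)
  then have "(\<integral>P. ?f P \<partial>M) = 1"
    using \<phi> m1(1) m2(1) by (subst integral_cong_AE[where g = "\<lambda>_. 1"]) (auto simp: prob_space)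
  moreover have "(\<integral>P. ?f P \<partial>M) = measure M (?A \<phi>) + measure M (?A (\<lambda>P. \<phi> (g ` P))) + measure M (?A (\<lambda>P. \<phi> (g ` g ` P)))"
  proof -
    have int: "integrable M (indicator A :: _ \<Rightarrow> real)" and val: "(\<integral>P. indicator A P \<partial>M) = measure M A"
      if "A \<in> sets M" for A
      using that sets.sets_into_space[OF that]
      by (simp_all add: integrable_real_indicator emeasure_eq_measure Int_absorb2)
    show ?thesis
      using int[OF \<phi>] int[OF m1(1)] int[OF m2(1)] val[OF \<phi>] val[OF m1(1)] val[OF m2(1)]
      by (simp add: Bochner_Integration.integral_add)
  qed
  ultimately show ?thesis using m1(2) m2(2) by simp
qed

definition three_cycle :: "4 \<Rightarrow> 4" where
  "three_cycle i = (if i = 2 then 3 else if i = 3 then 4 else if i = 4 then 2 else 1)"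

definition cycle_coords :: "real^4 \<Rightarrow> real^4" where
  "cycle_coords x = (\<chi> i. x $ three_cycle i)"

lemma three_cycle_simps [simp]:
  "three_cycle 1 = 1" "three_cycle 2 = 3" "three_cycle 3 = 4" "three_cycle 4 = 2"
  by (simp_all add: three_cycle_def)

lemma orthogonal_cycle_coords: "orthogonal_transformation cycle_coords"
proof -
  have "linear cycle_coords" by (intro linearI) (simp_all add: cycle_coords_def vec_eq_iff)
  moreover have "cycle_coords x \<bullet> cycle_coords y = x \<bullet> y" for x y
    by (simp add: inner_vec_def sum_4 cycle_coords_def)
  ultimately show ?thesis by (simp add: orthogonal_transformation_def)
qed

lemma turn_product_cycle_coords:
  assumes "P \<in> grassmannian"
  shows "turn_product i j k l (cycle_coords ` P) =
    turn_product (three_cycle i) (three_cycle j) (three_cycle k) (three_cycle l) P"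
proof -
  obtain u v where uv: "orthonormal_basis u v P" using plane_has_orthonormal_basis[OF assms] .
  show ?thesis
    unfolding turn_product_eq[OF uv] turn_product_eq[OF orthonormal_basis_image[OF orthogonal_cycle_coords uv]]
    by (simp add: turn_eq proj_def minor_def cycle_coords_def)
qed

text \<open>With \<open>b = - a - c\<close> and all three numbers nonzero, the signs of \<open>a, b, c\<close> are not all equal.  In cyclic order they
  therefore change once from minus to plus and once from plus to minus; the position of the one
  change tells whether the quadrilateral is convex, that of the other whether it is self-intersecting.\<close>

lemma shape_probabilities:
  assumes M: "invariant_probability M"
  shows "measure (symmetric_measure M) {q \<in> quad_classes. \<forall>e\<in>q. convex_quad e} = 1/3"
    and "measure (symmetric_measure M) {q \<in> quad_classes. \<forall>e\<in>q. reflex e} = 1/3"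
    and "measure (symmetric_measure M) {q \<in> quad_classes. \<forall>e\<in>q. self_intersecting e} = 1/3"
proof -
  interpret prob_space M using M by (simp add: invariant_probability_def)
  let ?a = "turn_product 1 2 3 4" and ?b = "turn_product 1 3 4 2" and ?c = "turn_product 1 4 2 3"
  let ?g = "\<lambda>P. cycle_coords ` P"
  let ?convex = "\<lambda>P. ?a P > 0 \<and> ?c P < 0" and ?crossed = "\<lambda>P. ?a P < 0 \<and> ?c P > 0"
    and ?reflex = "\<lambda>P. \<not> (?a P > 0 \<and> ?c P < 0) \<and> \<not> (?a P < 0 \<and> ?c P > 0)"
  note space = space_invariant[OF M]
  have g: "?g P \<in> grassmannian" if "P \<in> grassmannian" for P
    by (rule orthogonal_image_grassmannian[OF orthogonal_cycle_coords that])
  have cycle: "?a (?g P) = ?b P" "?b (?g P) = ?c P" "?c (?g P) = ?a P" if P: "P \<in> grassmannian" for P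
  proof -
    obtain u v where uv: "orthonormal_basis u v P" using plane_has_orthonormal_basis[OF P] .
    show "?a (?g P) = ?b P" "?b (?g P) = ?c P" "?c (?g P) = ?a P"
      by (simp_all add: turn_product_cycle_coords[OF P] turn_product_eq[OF uv] mult.commute)
  qed
  have nonzero: "?a P \<noteq> 0 \<and> ?b P \<noteq> 0 \<and> ?c P \<noteq> 0" if P: "P \<in> grassmannian" "on_plane generic P" for P
  proof -
    obtain u v where uv: "orthonormal_basis u v P" using plane_has_orthonormal_basis[OF P(1)] .
    have "generic u v" using P(2) on_plane_eq[OF basis_invariant_generic uv] by simp
    then show ?thesis by (simp add: turn_product_eq[OF uv] generic_def)
  qed
  have signs: "AE P in M. P \<in> grassmannian \<and> ?a P + ?b P + ?c P = 0 \<and> ?a P \<noteq> 0 \<and> ?b P \<noteq> 0 \<and> ?c P \<noteq> 0"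
    using AE_generic[OF M] AE_space by eventually_elim (use nonzero turn_product_pluecker space in auto)
  have sets: "{P \<in> grassmannian. ?convex P} \<in> sets M" "{P \<in> grassmannian. ?crossed P} \<in> sets M"
    by (intro sets_Collect_invariant[OF M] level_sets_invariant[OF M] measurable_turns)+
  have convex: "measure M {P \<in> grassmannian. ?convex P} = 1 / 3"
  proof (rule one_third_by_three_cycle[OF M orthogonal_cycle_coords sets(1)])
    show "AE P in M. ?convex P \<and> \<not> ?convex (?g P) \<and> \<not> ?convex (?g (?g P))
        \<or> \<not> ?convex P \<and> ?convex (?g P) \<and> \<not> ?convex (?g (?g P))
        \<or> \<not> ?convex P \<and> \<not> ?convex (?g P) \<and> ?convex (?g (?g P))"
      using signs
    proof eventually_elim
      case (elim P)
      then show ?case by (simp only: cycle g) linarith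
    qed
  qed
  have crossed: "measure M {P \<in> grassmannian. ?crossed P} = 1 / 3"
  proof (rule one_third_by_three_cycle[OF M orthogonal_cycle_coords sets(2)])
    show "AE P in M. ?crossed P \<and> \<not> ?crossed (?g P) \<and> \<not> ?crossed (?g (?g P))
        \<or> \<not> ?crossed P \<and> ?crossed (?g P) \<and> \<not> ?crossed (?g (?g P))
        \<or> \<not> ?crossed P \<and> \<not> ?crossed (?g P) \<and> ?crossed (?g (?g P))"
      using signs
    proof eventually_elim
      case (elim P)
      then show ?case by (simp only: cycle g) linarith
    qed
  qed
  have complement: "{P \<in> grassmannian. ?reflex P} =
      space M - ({P \<in> grassmannian. ?convex P} \<union> {P \<in> grassmannian. ?crossed P})"
    unfolding space by blast
  have disjoint: "{P \<in> grassmannian. ?convex P} \<inter> {P \<in> grassmannian. ?crossed P} = {}" by auto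
  have reflex_sets: "{P \<in> grassmannian. ?reflex P} \<in> sets M" unfolding complement using sets by auto
  have reflex: "measure M {P \<in> grassmannian. ?reflex P} = 1 / 3"
    unfolding complement using sets convex crossed
    by (subst prob_compl) (auto simp: finite_measure_Union[OF sets disjoint])
  show "measure (symmetric_measure M) {q \<in> quad_classes. \<forall>e\<in>q. convex_quad e} = 1/3"
    using symmetric_measure_of_class[OF M sets(1)] plane_shape(1) convex by simp
  show "measure (symmetric_measure M) {q \<in> quad_classes. \<forall>e\<in>q. self_intersecting e} = 1/3"
    using symmetric_measure_of_class[OF M sets(2)] plane_shape(3) crossed by simp
  have "?a P * ?c P > 0 \<longleftrightarrow> ?reflex P" if "P \<in> grassmannian" "on_plane generic P" for P
    using nonzero[OF that] by (auto simp: zero_less_mult_iff)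
  then show "measure (symmetric_measure M) {q \<in> quad_classes. \<forall>e\<in>q. reflex e} = 1/3"
    using symmetric_measure_of_class[OF M reflex_sets] plane_shape(2) reflex by simp
qed

section \<open>Sign cells as fibres of a finite code\<close>

lemma sign_matrix_plucker_nth: "sign_matrix (plucker u v) $ i $ j = sgn (minor u v i j)"
  by (simp add: sign_matrix_def plucker_def minor_def)

lemma sign_matrix_projection_nth: "sign_matrix (projection_matrix u v) $ i $ j = sgn (proj u v i j)"
  by (simp add: sign_matrix_def projection_matrix_def basis_matrix_def matrix_matrix_mult_def
      transpose_def sum_2 proj_def)

definition same_signs :: "real^4 \<Rightarrow> real^4 \<Rightarrow> real^4 \<Rightarrow> real^4 \<Rightarrow> bool" where
  "same_signs u v x y \<longleftrightarrow> (\<exists>s. (s = 1 \<or> s = (-1::real)) \<and>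
     (\<forall>i j. sgn (minor x y i j) = s * sgn (minor u v i j)) \<and>
     (\<forall>i j. sgn (proj x y i j) = sgn (proj u v i j)))"

lemma same_signs_matrices:
  "same_signs u v x y \<longleftrightarrow>
     (sign_matrix (plucker x y) = sign_matrix (plucker u v) \<or>
      sign_matrix (plucker x y) = - sign_matrix (plucker u v)) \<and>
     sign_matrix (projection_matrix x y) = sign_matrix (projection_matrix u v)"
  by (auto simp: same_signs_def vec_eq_iff sign_matrix_plucker_nth sign_matrix_projection_nth)

lemma mult_sign_iff_sgn:
  fixes x y :: real
  assumes "x \<noteq> 0" "y \<noteq> 0"
  shows "x * y > 0 \<longleftrightarrow> sgn x = sgn y" "x * y < 0 \<longleftrightarrow> sgn x \<noteq> sgn y"
  using assms by (auto simp: zero_less_mult_iff mult_less_0_iff sgn_if)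

text \<open>The quotients \<open>z\<^sub>j / z\<^sub>i\<close>, \<open>z\<^sub>k / z\<^sub>j\<close>, \<open>z\<^sub>i / z\<^sub>k\<close> have product 1.  Changing signs to make their real parts
  positive, their arguments lie between \<open>- \<pi>/2\<close> and \<open>\<pi>/2\<close> and sum to a multiple of \<open>\<pi>\<close>; the sum is
  \<open>\<plusminus>\<pi>\<close> if all three arguments have the same sign and \<open>0\<close> otherwise.  So the turns determine the
  sign of the product of the three real parts, that is, of the three entries of the projection matrix.  The proof expresses the
  addition theorems for two of the angles polynomially (\<open>re\<close> and \<open>im\<close>).\<close>

lemma proj_sign_of_triple:
  assumes "turn u v i j \<noteq> 0" "turn u v j k \<noteq> 0" "turn u v k i \<noteq> 0"
  shows "sgn (proj u v j k) = (if sgn (turn u v i j) = sgn (turn u v j k) \<and> sgn (turn u v j k) = sgn (turn u v k i)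
     then -1 else 1) * sgn (proj u v i j) * sgn (proj u v i k)"
proof -
  define p q r where "p = proj u v i j" and "q = proj u v j k" and "r = proj u v k i"
  define D E F where "D = minor u v i j" and "E = minor u v j k" and "F = minor u v k i"
  have nz: "p \<noteq> 0" "q \<noteq> 0" "r \<noteq> 0" "D \<noteq> 0" "E \<noteq> 0" "F \<noteq> 0"
    using assms by (auto simp: turn_eq p_def q_def r_def D_def E_def F_def)
  have pos: "proj u v m m > 0" if "minor u v m n \<noteq> 0" for m n
    using that by (auto simp: proj_def minor_def sum_squares_gt_zero_iff)
  have n: "proj u v i i > 0" "proj u v j j > 0" "proj u v k k > 0"
    using nz pos unfolding D_def E_def F_def by blast+
  have re: "p * q - D * E = proj u v j j * r" "q * r - E * F = proj u v k k * p"
    "r * p - F * D = proj u v i i * q" and im: "p * E + D * q = - (proj u v j j * F)"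
    by (simp_all add: p_def q_def r_def D_def E_def F_def proj_def minor_def algebra_simps)
  have opposite: "a * b * c > 0"
    if rel: "a * b - A * B = m * c" and "m > 0" and opp: "(a * A) * (b * B) < 0" and "a \<noteq> 0" "b \<noteq> 0"
    for a b c A B m :: real
  proof -
    have "m * (a * b * c) = (a * b) * (a * b) - (a * A) * (b * B)"
      using arg_cong[OF rel, of "\<lambda>x. a * b * x"] by (simp add: algebra_simps)
    moreover have "(a * b) * (a * b) > 0"
      using that(4,5) by (metis mult_eq_0_iff not_real_square_gt_zero)
    ultimately have "m * (a * b * c) > 0" using opp by linarith
    then show ?thesis using \<open>m > 0\<close> by (simp only: zero_less_mult_iff) auto
  qed
  have turns: "turn u v i j = 2 * (p * D)" "turn u v j k = 2 * (q * E)" "turn u v k i = 2 * (r * F)"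
    by (simp_all add: turn_eq p_def q_def r_def D_def E_def F_def)
  have nzt: "p * D \<noteq> 0" "q * E \<noteq> 0" "r * F \<noteq> 0" using nz by simp_all
  have product: "sgn (p * q * r) = (if sgn (p * D) = sgn (q * E) \<and> sgn (q * E) = sgn (r * F) then -1 else 1)"
  proof (cases "sgn (p * D) = sgn (q * E) \<and> sgn (q * E) = sgn (r * F)")
    case True
    have eq: "(proj u v j j * (F * F)) * (p * q * r)
        = - (p * p * ((q * E) * (r * F)) + q * q * ((p * D) * (r * F)))"
      using arg_cong[OF im, of "\<lambda>x. p * q * r * F * x"] by (simp add: algebra_simps)
    have "sgn (q * E) = sgn (r * F)" "sgn (p * D) = sgn (r * F)" using True by argo+
    then have "(q * E) * (r * F) > 0" "(p * D) * (r * F) > 0"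
      using mult_sign_iff_sgn(1)[OF nzt(2,3)] mult_sign_iff_sgn(1)[OF nzt(1,3)] by blast+
    moreover have "p * p > 0" "q * q > 0" using nz not_real_square_gt_zero by blast+
    ultimately have "p * p * ((q * E) * (r * F)) + q * q * ((p * D) * (r * F)) > 0"
      by (intro add_pos_pos) (rule mult_pos_pos; assumption)+
    then have "(proj u v j j * (F * F)) * (p * q * r) < 0" unfolding eq by simp
    moreover have "proj u v j j * (F * F) > 0"
      using mult_pos_pos[OF n(2)] nz(6) not_real_square_gt_zero[of F] by blast
    ultimately have "p * q * r < 0"
      using mult_less_0_iff[of "proj u v j j * (F * F)" "p * q * r"] by linarith
    then show ?thesis using True by simp
  next
    case False
    then have "(p * D) * (q * E) < 0 \<or> (q * E) * (r * F) < 0 \<or> (r * F) * (p * D) < 0"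
      using mult_sign_iff_sgn(2)[OF nzt(1,2)] mult_sign_iff_sgn(2)[OF nzt(2,3)] mult_sign_iff_sgn(2)[OF nzt(3,1)]
      by argo
    then have "p * q * r > 0"
      using opposite[OF re(1) n(2)] opposite[OF re(2) n(3)] opposite[OF re(3) n(1)] nz
      by (auto simp: mult.commute mult.left_commute)
    then show ?thesis using False by simp
  qed
  have "sgn q = sgn (p * q * r) * sgn p * sgn r"
  proof -
    have "sgn p * sgn p = 1" "sgn r * sgn r = 1" using nz by (simp_all add: sgn_if)
    moreover have "sgn (p * q * r) * sgn p * sgn r = (sgn p * sgn p) * sgn q * (sgn r * sgn r)"
      by (simp only: sgn_mult mult_ac)
    ultimately show ?thesis by simp
  qed
  then show ?thesis
    unfolding product turns q_def[symmetric] p_def[symmetric] proj_commute[of u v i k] r_def[symmetric]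
    by (simp add: sgn_mult)
qed

text \<open>The bits record the signs of \<open>x\<^sub>2\<^sub>3, x\<^sub>3\<^sub>4, x\<^sub>4\<^sub>1, x\<^sub>1\<^sub>3, x\<^sub>2\<^sub>4\<close> relative to \<open>x\<^sub>1\<^sub>2\<close>, which makes them independent
  of the orientation of the basis, and the signs of three entries of the projection matrix.\<close>

type_synonym plane_code = "(bool \<times> bool \<times> bool \<times> bool \<times> bool) \<times> (bool \<times> bool \<times> bool)"

definition sign_code :: "real^4 \<Rightarrow> real^4 \<Rightarrow> plane_code" where
  "sign_code u v =
    ((turn u v 1 2 * turn u v 2 3 > 0, turn u v 1 2 * turn u v 3 4 > 0, turn u v 1 2 * turn u v 4 1 > 0,
      turn u v 1 2 * turn u v 1 3 > 0, turn u v 1 2 * turn u v 2 4 > 0),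
     (proj u v 1 2 > 0, proj u v 1 3 > 0, proj u v 1 4 > 0))"

lemma basis_invariant_sign_code: "basis_invariant sign_code"
  by (rule basis_invariantI) (auto simp: sign_code_def turn_eq)

lemma turn_self [simp]: "turn u v i i = 0"
  by (simp add: turn_eq minor_def)

lemma all_pairs_4:
  fixes i j :: 4
  assumes "\<And>i. R i i" "\<And>i j. R i j \<Longrightarrow> R j i" "R 1 2" "R 1 3" "R 1 4" "R 2 3" "R 2 4" "R 3 4"
  shows "R i j"
  using exhaust_4[of i] exhaust_4[of j] assms by auto

lemma sgn_eq_of_products:
  fixes a b c d :: real
  assumes "a * b > 0 \<longleftrightarrow> c * d > 0" "a \<noteq> 0" "b \<noteq> 0" "c \<noteq> 0" "d \<noteq> 0"
  shows "sgn d = (sgn c * sgn a) * sgn b"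
  using assms by (auto simp: zero_less_mult_iff sgn_if)

text \<open>The code fixes the signs of all turns up to one common sign \<open>s\<close>.  The triples \<open>1, j, k\<close> then give the
  remaining signs of the projection matrix, and dividing the turns by them gives the minors.\<close>

lemma sign_code_eq_imp_same_signs:
  assumes gen: "generic u v" "generic x y" and code: "sign_code x y = sign_code u v"
  shows "same_signs u v x y"
proof -
  have nz: "turn u v i j \<noteq> 0" "turn x y i j \<noteq> 0" if "i \<noteq> j" for i j
    using gen that by (auto simp: generic_def)
  define s where "s = sgn (turn x y 1 2) * sgn (turn u v 1 2)"
  have s: "s = 1 \<or> s = -1" using nz[of 1 2] by (auto simp: s_def sgn_if)
  have products: "turn u v 1 2 * turn u v i j > 0 \<longleftrightarrow> turn x y 1 2 * turn x y i j > 0"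
    if "(i, j) \<in> {(2, 3), (3, 4), (4, 1), (1, 3), (2, 4)}" for i j
    using code that by (auto simp: sign_code_def)
  have listed: "sgn (turn x y i j) = s * sgn (turn u v i j)"
    if "(i, j) \<in> {(2, 3), (3, 4), (4, 1), (1, 3), (2, 4)}" for i j
    unfolding s_def by (rule sgn_eq_of_products[OF products[OF that]]; rule nz; use that in fastforce)
  have turn: "sgn (turn x y i j) = s * sgn (turn u v i j)" for i j
  proof (rule all_pairs_4[of "\<lambda>i j. sgn (turn x y i j) = s * sgn (turn u v i j)"])
    fix i j assume "sgn (turn x y i j) = s * sgn (turn u v i j)"
    then show "sgn (turn x y j i) = s * sgn (turn u v j i)"
      by (simp add: turn_antisym[of x y j i] turn_antisym[of u v j i])
  next
    show "sgn (turn x y 1 2) = s * sgn (turn u v 1 2)"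
      using nz[of 1 2] by (simp add: s_def sgn_if)
    have "sgn (turn x y 4 1) = s * sgn (turn u v 4 1)" by (rule listed) simp
    then show "sgn (turn x y 1 4) = s * sgn (turn u v 1 4)"
      by (simp add: turn_antisym[of x y 4 1] turn_antisym[of u v 4 1])
  qed (simp_all add: listed turn_self)
  have nzp: "proj u v i j \<noteq> 0" "proj x y i j \<noteq> 0" if "i \<noteq> j" for i j
    using nz[OF that] by (auto simp: turn_eq)
  have first: "sgn (proj x y 1 j) = sgn (proj u v 1 j)" if "j \<in> {2, 3, 4}" for j
  proof -
    have "proj x y 1 j > 0 \<longleftrightarrow> proj u v 1 j > 0" using code that unfolding sign_code_def by auto
    moreover have "1 \<noteq> j" using that by auto
    ultimately show ?thesis using nzp by (simp add: sgn_if)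
  qed
  have triple: "sgn (proj x y j k) = sgn (proj u v j k)" if jk: "j \<in> {2, 3, 4}" "k \<in> {2, 3, 4}" "j \<noteq> k" for j k
  proof -
    have ne: "1 \<noteq> j" "j \<noteq> k" "k \<noteq> 1" using jk by auto
    have "(s * a = s * b \<and> s * b = s * c) \<longleftrightarrow> (a = b \<and> b = c)" for a b c :: real using s by auto
    then show ?thesis
      unfolding proj_sign_of_triple[OF nz(1)[OF ne(1)] nz(1)[OF ne(2)] nz(1)[OF ne(3)]]
        proj_sign_of_triple[OF nz(2)[OF ne(1)] nz(2)[OF ne(2)] nz(2)[OF ne(3)]]
        turn first[OF jk(1)] first[OF jk(2)] by simp
  qed
  have proj: "sgn (proj x y i j) = sgn (proj u v i j)" for i j
  proof (rule all_pairs_4[of "\<lambda>i j. sgn (proj x y i j) = sgn (proj u v i j)"])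
    fix i :: 4
    obtain j where "i \<noteq> j" using exhaust_4[of i] by (metis zero_neq_one zero_neq_numeral)
    then have "minor u v i j \<noteq> 0" "minor x y i j \<noteq> 0" using nz by (auto simp: turn_eq)
    then have "proj u v i i > 0" "proj x y i i > 0"
      by (auto simp: proj_def minor_def sum_squares_gt_zero_iff)
    then show "sgn (proj x y i i) = sgn (proj u v i i)" by simp
  next
    fix i j assume "sgn (proj x y i j) = sgn (proj u v i j)"
    then show "sgn (proj x y j i) = sgn (proj u v j i)" by (simp only: proj_commute[of _ _ j i])
  qed (simp_all add: first triple)
  have "sgn (minor x y i j) = s * sgn (minor u v i j)" for i j
  proof (cases "i = j")
    case False
    have "sgn (minor w z i j) = sgn (turn w z i j) * sgn (proj w z i j)" if "proj w z i j \<noteq> 0" for w z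
    proof -
      have "sgn (proj w z i j) * sgn (proj w z i j) = 1" using that by (simp add: sgn_if)
      then show ?thesis by (simp add: turn_eq sgn_mult mult.commute mult.left_commute)
    qed
    then show ?thesis using nzp[OF False] turn proj by simp
  qed (simp add: minor_def)
  then show ?thesis using s proj unfolding same_signs_def by blast
qed

lemma same_signs_imp_sign_code_eq:
  assumes gen: "generic u v" and same: "same_signs u v x y"
  shows "generic x y" "sign_code x y = sign_code u v"
proof -
  obtain s where s: "s = 1 \<or> s = (-1::real)" and minor: "\<And>i j. sgn (minor x y i j) = s * sgn (minor u v i j)"
    and proj: "\<And>i j. sgn (proj x y i j) = sgn (proj u v i j)"
    using same unfolding same_signs_def by blast
  have turn: "sgn (turn x y i j) = s * sgn (turn u v i j)" for i j
    by (simp add: turn_eq sgn_mult minor proj)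
  show "generic x y"
    using gen s turn unfolding generic_def by (metis mult_eq_0_iff sgn_zero_iff zero_neq_neg_one zero_neq_one)
  have pos: "a > 0 \<longleftrightarrow> sgn a = 1" for a :: real by (simp add: sgn_if)
  have "sgn (turn x y i j * turn x y k l) = sgn (turn u v i j * turn u v k l)" for i j k l
    using s by (auto simp: sgn_mult turn)
  then show "sign_code x y = sign_code u v" by (simp only: sign_code_def pos proj)
qed

definition generic_planes :: "(real^4) set set" where
  "generic_planes = {P \<in> grassmannian. on_plane generic P}"

definition code_fibre :: "plane_code \<Rightarrow> (real^4) set set" where
  "code_fibre k = {P \<in> generic_planes. on_plane sign_code P = k}"

lemma planes_with_signs_eq_code_fibre:
  assumes "generic u v"
  shows "planes_with_signs (sign_matrix (plucker u v)) (sign_matrix (projection_matrix u v))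
    = code_fibre (sign_code u v)"
proof (intro set_eqI iffI)
  fix P assume "P \<in> planes_with_signs (sign_matrix (plucker u v)) (sign_matrix (projection_matrix u v))"
  then obtain x y where P: "P \<in> grassmannian" and xy: "orthonormal_basis x y P" and "same_signs u v x y"
    unfolding planes_with_signs_def same_signs_matrices by blast
  then have "generic x y" "sign_code x y = sign_code u v"
    using same_signs_imp_sign_code_eq[OF assms] by blast+
  then show "P \<in> code_fibre (sign_code u v)"
    using P on_plane_eq[OF basis_invariant_generic xy] on_plane_eq[OF basis_invariant_sign_code xy]
    by (simp add: code_fibre_def generic_planes_def)
next
  fix P assume "P \<in> code_fibre (sign_code u v)"
  then have P: "P \<in> grassmannian" "on_plane generic P" "on_plane sign_code P = sign_code u v"
    by (auto simp: code_fibre_def generic_planes_def)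
  obtain x y where xy: "orthonormal_basis x y P" using plane_has_orthonormal_basis[OF P(1)] .
  have "generic x y" "sign_code x y = sign_code u v"
    using P on_plane_eq[OF basis_invariant_generic xy] on_plane_eq[OF basis_invariant_sign_code xy] by auto
  then have "same_signs u v x y" by (rule sign_code_eq_imp_same_signs[OF assms])
  then show "P \<in> planes_with_signs (sign_matrix (plucker u v)) (sign_matrix (projection_matrix u v))"
    using P(1) xy unfolding planes_with_signs_def same_signs_matrices by blast
qed

lemma planes_with_signs_minus: "planes_with_signs (- S) T = planes_with_signs S T"
  by (auto simp: planes_with_signs_def)

lemma generic_iff_nonzero_signs:
  "generic u v \<longleftrightarrow> (\<forall>i j. i \<noteq> j \<longrightarrow> sign_matrix (plucker u v) $ i $ j \<noteq> 0) \<and>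
     (\<forall>i j. sign_matrix (projection_matrix u v) $ i $ j \<noteq> 0)"
proof
  assume gen: "generic u v"
  have "proj u v i i \<noteq> 0" for i
  proof -
    obtain j where "i \<noteq> j" using exhaust_4[of i] by (metis zero_neq_one zero_neq_numeral)
    then have "minor u v i j \<noteq> 0" using gen by (auto simp: generic_def turn_eq)
    then show ?thesis by (auto simp: proj_diag_eq_0 minor_def)
  qed
  then have "proj u v i j \<noteq> 0" for i j
    using gen by (cases "i = j") (auto simp: generic_def turn_eq)
  then show "(\<forall>i j. i \<noteq> j \<longrightarrow> sign_matrix (plucker u v) $ i $ j \<noteq> 0) \<and>
     (\<forall>i j. sign_matrix (projection_matrix u v) $ i $ j \<noteq> 0)"
    using gen by (auto simp: sign_matrix_plucker_nth sign_matrix_projection_nth sgn_zero_iff generic_def turn_eq)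
qed (auto simp: sign_matrix_plucker_nth sign_matrix_projection_nth sgn_zero_iff generic_def turn_eq)

lemma sign_cells_eq_code_fibres: "sign_cells = code_fibre ` (on_plane sign_code ` generic_planes)"
proof (intro set_eqI iffI)
  fix C assume "C \<in> sign_cells"
  then obtain S T where C: "C = planes_with_signs S T" and "C \<noteq> {}"
    and nz: "\<forall>i j. i \<noteq> j \<longrightarrow> S $ i $ j \<noteq> 0" "\<forall>i j. T $ i $ j \<noteq> 0"
    unfolding sign_cells_def by auto
  then obtain P where "P \<in> planes_with_signs S T" by blast
  then obtain u v where P: "P \<in> grassmannian" and uv: "orthonormal_basis u v P"
    and S: "sign_matrix (plucker u v) = S \<or> sign_matrix (plucker u v) = - S"
    and T: "sign_matrix (projection_matrix u v) = T"
    unfolding planes_with_signs_def by blast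
  have "\<forall>i j. i \<noteq> j \<longrightarrow> sign_matrix (plucker u v) $ i $ j \<noteq> 0" using S nz(1) by auto
  then have gen: "generic u v" unfolding generic_iff_nonzero_signs using T nz(2) by simp
  have "C = planes_with_signs (sign_matrix (plucker u v)) (sign_matrix (projection_matrix u v))"
    using S unfolding C T by (auto simp: planes_with_signs_minus)
  then have "C = code_fibre (on_plane sign_code P)"
    using planes_with_signs_eq_code_fibre[OF gen] on_plane_eq[OF basis_invariant_sign_code uv] by simp
  moreover have "P \<in> generic_planes"
    using P gen on_plane_eq[OF basis_invariant_generic uv] by (simp add: generic_planes_def)
  ultimately show "C \<in> code_fibre ` (on_plane sign_code ` generic_planes)" by blast
next
  fix C assume "C \<in> code_fibre ` (on_plane sign_code ` generic_planes)"
  then obtain P where C: "C = code_fibre (on_plane sign_code P)" and P: "P \<in> grassmannian" "on_plane generic P"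
    by (auto simp: generic_planes_def)
  obtain u v where uv: "orthonormal_basis u v P" using plane_has_orthonormal_basis[OF P(1)] .
  have gen: "generic u v" using P(2) on_plane_eq[OF basis_invariant_generic uv] by simp
  have "C = planes_with_signs (sign_matrix (plucker u v)) (sign_matrix (projection_matrix u v))"
    using C planes_with_signs_eq_code_fibre[OF gen] on_plane_eq[OF basis_invariant_sign_code uv] by simp
  moreover have "P \<in> C" using C P by (simp add: code_fibre_def generic_planes_def)
  ultimately show "C \<in> sign_cells"
    using gen unfolding generic_iff_nonzero_signs sign_cells_def by blast
qed

section \<open>The realised codes\<close>

text \<open>Scale so that \<open>x\<^sub>1\<^sub>2 > 0\<close>.  The first three entries then give the signs of the turns \<open>x\<^sub>2\<^sub>3, x\<^sub>3\<^sub>4, x\<^sub>4\<^sub>1\<close>.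
  The first four codes have four left turns, the next four have one exceptional turn, and the last four have
  two right turns next to each other.\<close>

definition turn_codes :: "(bool \<times> bool \<times> bool \<times> bool \<times> bool) set" where
  "turn_codes =
    {(True, True, True, True, True), (True, True, True, True, False),
     (True, True, True, False, True), (True, True, True, False, False),
     (True, True, False, False, False), (True, False, True, False, True),
     (False, True, True, True, True), (False, False, False, False, True),
     (True, False, False, False, True), (True, False, False, False, False),
     (False, False, True, True, True), (False, False, True, False, True)}"

text \<open>The implications are those forced by \<open>x\<^sub>1\<^sub>3 = x\<^sub>3\<^sub>4 - x\<^sub>2\<^sub>3 = x\<^sub>4\<^sub>1 - x\<^sub>1\<^sub>2\<close> and \<open>x\<^sub>2\<^sub>4 = x\<^sub>1\<^sub>2 - x\<^sub>2\<^sub>3 = x\<^sub>4\<^sub>1 - x\<^sub>3\<^sub>4\<close>.\<close>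

lemma turn_codes_iff:
  "(b, c, d, m, n) \<in> turn_codes \<longleftrightarrow>
     (\<not> b \<longrightarrow> n) \<and> (c \<and> \<not> b \<longrightarrow> m) \<and> (\<not> c \<and> b \<longrightarrow> \<not> m) \<and>
     (\<not> d \<longrightarrow> \<not> m) \<and> (d \<and> \<not> c \<longrightarrow> n) \<and> (\<not> d \<and> c \<longrightarrow> \<not> n)"
  by (cases b; cases c; cases d; cases m; cases n) (simp_all add: turn_codes_def)

lemma turn_code_of_signs:
  fixes p q r s x y :: real
  assumes "p > 0" "p + r = q + s" "x = r - q" "y = p - q"
  shows "(q > 0, r > 0, s > 0, x > 0, y > 0) \<in> turn_codes"
  unfolding turn_codes_iff by (intro conjI impI; use assms in linarith)

lemma fst_sign_code_in_turn_codes: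
  assumes st: "(u, v) \<in> stiefel" and nz: "turn u v 1 2 \<noteq> 0"
  shows "fst (sign_code u v) \<in> turn_codes"
proof -
  let ?t = "turn u v"
  note rows = turn_row_sum[OF st]
  have anti: "?t 2 1 = - ?t 1 2" "?t 3 1 = - ?t 1 3" "?t 4 1 = - ?t 1 4" "?t 3 2 = - ?t 2 3"
    "?t 4 2 = - ?t 2 4" "?t 4 3 = - ?t 3 4" "?t 1 1 = 0" "?t 2 2 = 0" "?t 3 3 = 0" "?t 4 4 = 0"
    by (simp_all add: turn_antisym[of u v 2 1] turn_antisym[of u v 3 1] turn_antisym[of u v 4 1]
        turn_antisym[of u v 3 2] turn_antisym[of u v 4 2] turn_antisym[of u v 4 3]
        turn_eq[of u v 1 1] turn_eq[of u v 2 2] turn_eq[of u v 3 3] turn_eq[of u v 4 4] minor_def)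
  have rel: "?t 1 2 + ?t 3 4 = ?t 2 3 + ?t 4 1" "?t 1 3 = ?t 3 4 - ?t 2 3" "?t 2 4 = ?t 1 2 - ?t 2 3"
    using rows[of 1] rows[of 2] rows[of 3] by (simp_all add: anti)
  have "(?t 1 2 * ?t 2 3 > 0, ?t 1 2 * ?t 3 4 > 0, ?t 1 2 * ?t 4 1 > 0, ?t 1 2 * ?t 1 3 > 0, ?t 1 2 * ?t 2 4 > 0)
    \<in> turn_codes"
  proof (rule turn_code_of_signs[where p = "?t 1 2 * ?t 1 2"])
    show "?t 1 2 * ?t 1 2 > 0" using nz not_real_square_gt_zero[of "?t 1 2"] by blast
    show "?t 1 2 * ?t 1 2 + ?t 1 2 * ?t 3 4 = ?t 1 2 * ?t 2 3 + ?t 1 2 * ?t 4 1"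
      by (simp add: distrib_left[symmetric] rel(1))
    show "?t 1 2 * ?t 1 3 = ?t 1 2 * ?t 3 4 - ?t 1 2 * ?t 2 3"
      "?t 1 2 * ?t 2 4 = ?t 1 2 * ?t 1 2 - ?t 1 2 * ?t 2 3"
      by (simp_all only: right_diff_distrib[symmetric] rel(2,3))
  qed
  then show ?thesis by (simp add: sign_code_def)
qed

text \<open>The equation \<open>\<Sum> z\<^sub>i\<^sup>2 = 0\<close> says that the real and imaginary parts form orthogonal vectors of equal length.\<close>

lemma stiefel_of_square_roots:
  fixes z :: "4 \<Rightarrow> complex"
  assumes sum: "(\<Sum>i\<in>UNIV. (z i)\<^sup>2) = 0" and "z 1 \<noteq> 0"
  obtains u v k where "(u, v) \<in> stiefel" "k > 0"
    "\<And>i j. turn u v i j = k\<^sup>2 * wedge ((z i)\<^sup>2) ((z j)\<^sup>2)" "\<And>i j. proj u v i j = k * Re (cnj (z i) * z j)"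
proof -
  define L where "L = (\<Sum>i\<in>UNIV. (Re (z i))\<^sup>2)"
  have eq: "(\<Sum>i\<in>UNIV. (Im (z i))\<^sup>2) = L" and orth: "(\<Sum>i\<in>UNIV. Re (z i) * Im (z i)) = 0"
    using sum by (simp_all add: complex_eq_iff Re_power2 Im_power2 sum_subtractf L_def mult.assoc flip: sum_distrib_left)
  have "2 * L = (\<Sum>i\<in>UNIV. (norm (z i))\<^sup>2)"
    by (simp add: cmod_power2 sum.distrib eq) (simp add: L_def)
  also have "\<dots> > 0" using \<open>z 1 \<noteq> 0\<close> by (intro sum_pos2[of _ 1]) auto
  finally have L: "L > 0" by simp
  define u v :: "real^4" where "u = (\<chi> i. Re (z i) / sqrt L)" and "v = (\<chi> i. Im (z i) / sqrt L)"
  have "u \<bullet> u = 1" "v \<bullet> v = 1" "u \<bullet> v = 0"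
    using L eq orth by (simp_all add: u_def v_def inner_vec_def L_def[symmetric] power_divide flip: sum_divide_distrib power2_eq_square)
  then have "(u, v) \<in> stiefel" by (simp add: stiefel_def norm_eq_1)
  moreover have "proj u v i j = 1 / L * Re (cnj (z i) * z j)" for i j
    using L by (simp add: proj_def u_def v_def add_divide_distrib)
  moreover have minor: "minor u v i j = 1 / L * Im (cnj (z i) * z j)" for i j
    using L by (simp add: minor_def u_def v_def diff_divide_distrib algebra_simps)
  moreover have "wedge ((z i)\<^sup>2) ((z j)\<^sup>2) = 2 * Re (cnj (z i) * z j) * Im (cnj (z i) * z j)" for i j
    by (simp add: wedge_def Re_power2 Im_power2 power2_eq_square algebra_simps)
  ultimately show thesis
    using L by (intro that[of u v "1 / L"]) (simp_all add: turn_eq power2_eq_square)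
qed

text \<open>A plane with \<open>x\<^sub>1\<^sub>2, x\<^sub>2\<^sub>3, x\<^sub>3\<^sub>4\<close> proportional to \<open>2, \<beta>, \<gamma>\<close> comes from an explicit closed quadrilateral by
  taking square roots of its edges.  As \<open>z\<^sub>1 = 1\<close> and principal square roots have nonnegative real part, choosing the
  sign of the root \<open>z\<^sub>j\<close> chooses the sign of the entry \<open>1, j\<close> of the projection matrix.\<close>

lemma realize_code:
  fixes \<beta> \<gamma> :: real and t2 t3 t4 :: bool
  assumes nz: "\<beta> \<noteq> 0" "\<gamma> \<noteq> 0" "2 + \<gamma> - \<beta> \<noteq> 0" "\<gamma> - \<beta> \<noteq> 0" "2 - \<beta> \<noteq> 0"
  shows "((\<beta> > 0, \<gamma> > 0, 2 + \<gamma> - \<beta> > 0, \<gamma> - \<beta> > 0, 2 - \<beta> > 0), (t2, t3, t4))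
    \<in> on_plane sign_code ` generic_planes"
proof -
  \<comment> \<open>The first two edges are 1 and \<open>2 \<i>\<close>; the third is then determined by its areas with
    them, and the fourth closes the polygon.\<close>
  define e :: "4 \<Rightarrow> complex" where "e i = (if i = 1 then 1 else if i = 2 then Complex 0 2
     else if i = 3 then Complex (- \<beta> / 2) (\<gamma> - \<beta>) else Complex (\<beta> / 2 - 1) (\<beta> - \<gamma> - 2))" for i
  define \<epsilon> :: "4 \<Rightarrow> complex" where "\<epsilon> i = (if (if i = 2 then t2 else if i = 3 then t3 else if i = 4 then t4 else True) then 1 else -1)" for i
  define z where "z i = \<epsilon> i * csqrt (e i)" for i
  have e: "e 1 = 1" "e 2 = Complex 0 2" "e 3 = Complex (- \<beta> / 2) (\<gamma> - \<beta>)"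
    "e 4 = Complex (\<beta> / 2 - 1) (\<beta> - \<gamma> - 2)" by (simp_all add: e_def)
  have z2: "(z i)\<^sup>2 = e i" for i by (simp add: z_def power_mult_distrib \<epsilon>_def)
  have z1: "z 1 = 1" by (simp add: z_def e \<epsilon>_def)
  have "(\<Sum>i\<in>UNIV. (z i)\<^sup>2) = 0" by (simp add: sum_4 z2 e complex_eq_iff)
  then obtain u v k where st: "(u, v) \<in> stiefel" and k: "k > 0"
    and turn: "\<And>i j. turn u v i j = k\<^sup>2 * wedge (e i) (e j)" and proj: "\<And>i j. proj u v i j = k * Re (cnj (z i) * z j)"
    using stiefel_of_square_roots[of z] z1 unfolding z2 by auto
  have w: "wedge (e 1) (e 2) = 2" "wedge (e 2) (e 3) = \<beta>" "wedge (e 3) (e 4) = \<gamma>" "wedge (e 4) (e 1) = 2 + \<gamma> - \<beta>"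
    "wedge (e 1) (e 3) = \<gamma> - \<beta>" "wedge (e 2) (e 4) = 2 - \<beta>"
    by (simp_all add: e wedge_def algebra_simps add_divide_distrib diff_divide_distrib)
  have anti: "wedge a b = - wedge b a" for a b by (simp add: wedge_def)
  have "i \<noteq> j \<longrightarrow> wedge (e i) (e j) \<noteq> 0" for i j
  proof (rule all_pairs_4[of "\<lambda>i j. i \<noteq> j \<longrightarrow> wedge (e i) (e j) \<noteq> 0"])
    fix i j assume "i \<noteq> j \<longrightarrow> wedge (e i) (e j) \<noteq> 0"
    then show "j \<noteq> i \<longrightarrow> wedge (e j) (e i) \<noteq> 0" using anti[of "e j" "e i"] by auto
  next
    show "1 \<noteq> (4::4) \<longrightarrow> wedge (e 1) (e 4) \<noteq> 0" using nz w(4) anti[of "e 1" "e 4"] by linarith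
  qed (use nz in \<open>simp_all add: w\<close>)
  then have gen: "generic u v" using k by (simp add: generic_def turn)
  have "proj u v 1 j > 0 \<longleftrightarrow> \<epsilon> j = 1" if "j \<noteq> 1" for j
  proof -
    have "proj u v 1 j \<noteq> 0" using gen that by (auto simp: generic_def turn_eq)
    moreover have "proj u v 1 j = (if \<epsilon> j = 1 then 1 else -1) * (k * Re (csqrt (e j)))"
      unfolding proj z1 by (simp add: z_def \<epsilon>_def del: csqrt.simps)
    moreover have "k * Re (csqrt (e j)) \<ge> 0" using k Re_csqrt by (intro mult_nonneg_nonneg) auto
    ultimately show ?thesis by (cases "\<epsilon> j = 1"; simp del: csqrt.simps mult_eq_0_iff; linarith)
  qed
  then have "proj u v 1 2 > 0 \<longleftrightarrow> t2" "proj u v 1 3 > 0 \<longleftrightarrow> t3" "proj u v 1 4 > 0 \<longleftrightarrow> t4"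
    by (simp_all add: \<epsilon>_def)
  moreover have "turn u v 1 2 * turn u v i j > 0 \<longleftrightarrow> wedge (e i) (e j) > 0" for i j
    using k by (simp add: turn w zero_less_mult_iff)
  ultimately have code: "sign_code u v = ((\<beta> > 0, \<gamma> > 0, 2 + \<gamma> - \<beta> > 0, \<gamma> - \<beta> > 0, 2 - \<beta> > 0), (t2, t3, t4))"
    by (simp add: sign_code_def w)
  have uv: "orthonormal_basis u v (span {u, v})" by (rule orthonormal_basis_span[OF st])
  have "span {u, v} \<in> generic_planes"
    using gen span_stiefel[OF st] on_plane_eq[OF basis_invariant_generic uv] by (simp add: generic_planes_def)
  then show ?thesis using code on_plane_eq[OF basis_invariant_sign_code uv] by (metis imageI)
qed

lemma realized_codes: "on_plane sign_code ` generic_planes = turn_codes \<times> UNIV"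
proof
  show "on_plane sign_code ` generic_planes \<subseteq> turn_codes \<times> UNIV"
  proof
    fix k assume "k \<in> on_plane sign_code ` generic_planes"
    then obtain P where P: "P \<in> grassmannian" "on_plane generic P" and k: "k = on_plane sign_code P"
      by (auto simp: generic_planes_def)
    obtain u v where uv: "orthonormal_basis u v P" using plane_has_orthonormal_basis[OF P(1)] .
    have "(u, v) \<in> stiefel" using uv by (simp add: orthonormal_basis_def)
    moreover have "turn u v 1 2 \<noteq> 0"
      using P(2) on_plane_eq[OF basis_invariant_generic uv] by (simp add: generic_def)
    ultimately have "fst k \<in> turn_codes"
      using fst_sign_code_in_turn_codes[of u v] k on_plane_eq[OF basis_invariant_sign_code uv] by simp
    then show "k \<in> turn_codes \<times> UNIV" by (cases k) simp
  qed
  have witness: "(c, \<tau>) \<in> on_plane sign_code ` generic_planes"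
    if "c = (\<beta> > 0, \<gamma> > 0, 2 + \<gamma> - \<beta> > 0, \<gamma> - \<beta> > 0, 2 - \<beta> > 0)" "\<beta> \<noteq> 0" "\<gamma> \<noteq> 0"
      "2 + \<gamma> - \<beta> \<noteq> 0" "\<gamma> - \<beta> \<noteq> 0" "2 - \<beta> \<noteq> 0" for c \<tau> and \<beta> \<gamma> :: real
    using that realize_code[of \<beta> \<gamma>] by (cases \<tau>) auto
  show "turn_codes \<times> UNIV \<subseteq> on_plane sign_code ` generic_planes"
  proof (clarsimp simp only: subset_iff split_paired_all mem_Sigma_iff)
    fix a b c d e \<tau>1 \<tau>2 \<tau>3
    assume "(a, b, c, d, e) \<in> turn_codes"
    then show "((a, b, c, d, e), \<tau>1, \<tau>2, \<tau>3) \<in> on_plane sign_code ` generic_planes"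
      unfolding turn_codes_def insert_iff
      by (elim disjE)
        \<comment> \<open>One sample point \<open>\<beta>, \<gamma>\<close> in each of the 12 regions.\<close>
        (rule witness[of _ 1 2] witness[of _ 3 4] witness[of _ 1 "1/2"] witness[of _ 3 2]
             witness[of _ 4 1] witness[of _ 1 "-1/2"] witness[of _ "-1" 1] witness[of _ "-1" "-4"]
             witness[of _ 1 "-4"] witness[of _ 3 "-4"] witness[of _ "-2" "-1"] witness[of _ "-1" "-2"];
          simp; fail)+
  qed
qed

section \<open>Counting the cells\<close>

text \<open>Distinct codes have disjoint nonempty fibres, and each of the 8 choices of the last three bits occurs with every code of the turns.\<close>

lemma card_shape_cells:
  assumes "\<And>P. P \<in> generic_planes \<Longrightarrow>
      (\<forall>e\<in>quad_of_plane P. \<kappa> e) \<longleftrightarrow> \<phi> (fst (on_plane sign_code P))"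
  shows "card {C \<in> sign_cells. \<forall>P\<in>C. \<forall>e\<in>quad_of_plane P. \<kappa> e} = 8 * card {c \<in> turn_codes. \<phi> c}"
proof -
  have nonempty: "\<exists>P. P \<in> code_fibre k" if "k \<in> turn_codes \<times> UNIV" for k
    using that unfolding realized_codes[symmetric] code_fibre_def by blast
  have inj: "inj_on code_fibre (turn_codes \<times> UNIV)"
  proof (rule inj_onI)
    fix k l assume "k \<in> turn_codes \<times> (UNIV :: (bool \<times> bool \<times> bool) set)" "code_fibre k = code_fibre l"
    then obtain P where "P \<in> code_fibre k" "P \<in> code_fibre l" using nonempty by blast
    then show "k = l" by (simp add: code_fibre_def)
  qed
  have "(\<forall>P\<in>code_fibre k. \<forall>e\<in>quad_of_plane P. \<kappa> e) \<longleftrightarrow> \<phi> (fst k)" if "k \<in> turn_codes \<times> UNIV" for k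
    using nonempty[OF that] assms unfolding code_fibre_def by blast
  then have "{C \<in> code_fibre ` (turn_codes \<times> UNIV). \<forall>P\<in>C. \<forall>e\<in>quad_of_plane P. \<kappa> e}
      = code_fibre ` {k \<in> turn_codes \<times> UNIV. \<phi> (fst k)}"
    by blast
  moreover have "{k \<in> turn_codes \<times> (UNIV :: (bool \<times> bool \<times> bool) set). \<phi> (fst k)} = {c \<in> turn_codes. \<phi> c} \<times> UNIV"
    by auto
  ultimately have "{C \<in> sign_cells. \<forall>P\<in>C. \<forall>e\<in>quad_of_plane P. \<kappa> e} = code_fibre ` ({c \<in> turn_codes. \<phi> c} \<times> UNIV)"
    unfolding sign_cells_eq_code_fibres realized_codes by simp
  moreover have "inj_on code_fibre ({c \<in> turn_codes. \<phi> c} \<times> UNIV)"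
    by (rule inj_on_subset[OF inj]) auto
  ultimately have "card {C \<in> sign_cells. \<forall>P\<in>C. \<forall>e\<in>quad_of_plane P. \<kappa> e}
      = card ({c \<in> turn_codes. \<phi> c} \<times> (UNIV :: (bool \<times> bool \<times> bool) set))"
    by (simp only: card_image)
  also have "\<dots> = 8 * card {c \<in> turn_codes. \<phi> c}"
    by (simp add: card_cartesian_product card_prod)
  finally show ?thesis .
qed

lemma turn_product_signs_of_code:
  assumes P: "P \<in> generic_planes" and code: "fst (on_plane sign_code P) = (b, c, d, m, n)"
  shows "turn_product 1 2 3 4 P > 0 \<longleftrightarrow> c" "turn_product 1 4 2 3 P < 0 \<longleftrightarrow> (b \<longleftrightarrow> d)"
    "turn_product 1 2 3 4 P \<noteq> 0" "turn_product 1 4 2 3 P \<noteq> 0"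
proof -
  have P': "P \<in> grassmannian" "on_plane generic P" using P by (auto simp: generic_planes_def)
  obtain u v where uv: "orthonormal_basis u v P" using plane_has_orthonormal_basis[OF P'(1)] .
  have gen: "generic u v" using P'(2) on_plane_eq[OF basis_invariant_generic uv] by simp
  have bits: "b \<longleftrightarrow> turn u v 1 2 * turn u v 2 3 > 0" "c \<longleftrightarrow> turn u v 1 2 * turn u v 3 4 > 0"
    "d \<longleftrightarrow> turn u v 1 2 * turn u v 4 1 > 0"
    using code unfolding on_plane_eq[OF basis_invariant_sign_code uv] by (auto simp: sign_code_def)
  have nz: "turn u v 1 2 \<noteq> 0" "turn u v 2 3 \<noteq> 0" "turn u v 3 4 \<noteq> 0" "turn u v 4 1 \<noteq> 0"
    using gen by (auto simp: generic_def)
  show "turn_product 1 2 3 4 P > 0 \<longleftrightarrow> c" "turn_product 1 4 2 3 P < 0 \<longleftrightarrow> (b \<longleftrightarrow> d)"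
    "turn_product 1 2 3 4 P \<noteq> 0" "turn_product 1 4 2 3 P \<noteq> 0"
    unfolding turn_product_eq[OF uv] bits turn_antisym[of u v 1 4]
    using nz by (auto simp: zero_less_mult_iff mult_less_0_iff)
qed

theorem theorem26:
  shows "card sign_cells = 96 \<and>
     card {C \<in> sign_cells. \<forall>P\<in>C. \<forall>e\<in>quad_of_plane P. convex_quad e} = 32 \<and>
     card {C \<in> sign_cells. \<forall>P\<in>C. \<forall>e\<in>quad_of_plane P. reflex e} = 32 \<and>
     card {C \<in> sign_cells. \<forall>P\<in>C. \<forall>e\<in>quad_of_plane P. self_intersecting e} = 32 \<and>
     (\<forall>M. invariant_probability M \<longrightarrow>
        measure (symmetric_measure M) {q \<in> quad_classes. \<forall>e\<in>q. convex_quad e} = 1/3 \<and>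
        measure (symmetric_measure M) {q \<in> quad_classes. \<forall>e\<in>q. reflex e} = 1/3 \<and>
        measure (symmetric_measure M) {q \<in> quad_classes. \<forall>e\<in>q. self_intersecting e} = 1/3)"
proof -
  have shape: "(\<forall>e\<in>quad_of_plane P. convex_quad e) \<longleftrightarrow> (case fst (on_plane sign_code P) of (b, c, d, m, n) \<Rightarrow> c \<and> b = d)"
    "(\<forall>e\<in>quad_of_plane P. reflex e) \<longleftrightarrow> (case fst (on_plane sign_code P) of (b, c, d, m, n) \<Rightarrow> c \<noteq> (b = d))"
    "(\<forall>e\<in>quad_of_plane P. self_intersecting e) \<longleftrightarrow> (case fst (on_plane sign_code P) of (b, c, d, m, n) \<Rightarrow> \<not> c \<and> b \<noteq> d)"
    if P: "P \<in> generic_planes" for P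
  proof -
    obtain b c d m n where code: "fst (on_plane sign_code P) = (b, c, d, m, n)" by (metis prod_cases5)
    have "P \<in> grassmannian" "on_plane generic P" using P by (auto simp: generic_planes_def)
    note shape = plane_shape[OF this] and signs = turn_product_signs_of_code[OF P code]
    show "(\<forall>e\<in>quad_of_plane P. convex_quad e) \<longleftrightarrow> (case fst (on_plane sign_code P) of (b, c, d, m, n) \<Rightarrow> c \<and> b = d)"
      "(\<forall>e\<in>quad_of_plane P. reflex e) \<longleftrightarrow> (case fst (on_plane sign_code P) of (b, c, d, m, n) \<Rightarrow> c \<noteq> (b = d))"
      "(\<forall>e\<in>quad_of_plane P. self_intersecting e) \<longleftrightarrow> (case fst (on_plane sign_code P) of (b, c, d, m, n) \<Rightarrow> \<not> c \<and> b \<noteq> d)"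
      unfolding shape code prod.case zero_less_mult_iff using signs by linarith+
  qed
  have "card turn_codes = 12" by (simp add: turn_codes_def)
  then have "card sign_cells = 96"
    using card_shape_cells[of "\<lambda>_. True" "\<lambda>_. True"] by simp
  moreover have "card {c \<in> turn_codes. case c of (b, c, d, m, n) \<Rightarrow> c \<and> b = d} = 4"
    "card {c \<in> turn_codes. case c of (b, c, d, m, n) \<Rightarrow> c \<noteq> (b = d)} = 4"
    "card {c \<in> turn_codes. case c of (b, c, d, m, n) \<Rightarrow> \<not> c \<and> b \<noteq> d} = 4"
    unfolding turn_codes_def Collect_conj_eq Collect_mem_eq by (simp_all add: Int_insert_left)
  ultimately show ?thesis
    using card_shape_cells[OF shape(1)] card_shape_cells[OF shape(2)] card_shape_cells[OF shape(3)]
      shape_probabilities by simp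
qed

end
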